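(* Suppose that $\gamma^2I>\bar P_\gamma$, and consider the following iteration, with $M_1=\bar P_\gamma$, $$M_{k+1}=F_o(F_a(M_k)),\qquad k\in\{1,2,\dots,h\},$$ which can be run as long as $\gamma^2I-M_k$ is not singular. Then: (i) if $\gamma^2I-M_k>0$ for all $k\in\{1,\dots,h\}$, then $M_{k+1}\ge M_k$ for all $k\in\{1,\dots,h-1\}$; (ii) for every $h\in\mathbb{N}$, $\inf\{\gamma\mid\gamma^2I-M_h>0\}=\gamma_h$; (iii) for every $h\in\mathbb{N}$, $\gamma_{h+1}\ge\gamma_h$.
   Context: System: $x_{t+1}=Ax_t+Bu_t+w_t$, $t\in\mathbb{N}_0=\mathbb{N}\cup\{0\}$, with output $z_t=C_2x_t+D_{21}u_t$, where $x_t,w_t\in\mathbb{R}^{n_x}$, $u_t\in\mathbb{R}^{n_u}$, $C_2^\top D_{21}=0$, $Q:=C_2^\top C_2$, $R:=D_{21}^\top D_{21}>0$, $(A,B)$ controllable and $(A,C_2)$ observable. Inequalities between symmetric matrices are in the positive semidefinite (Loewner) order. For given $\gamma>0$ define the matrix transformations $F_a(P)=P+P(\gamma^2I-P)^{-1}P$, $F_c(P)=A^\top PA+Q-A^\top PB(B^\top PB+R)^{-1}B^\top PA$, $F_o(P)=A^\top PA+Q$. The iteration $P_{t+1}=F_c(F_a(P_t))$ with $P_0=0$ is monotone ($P_{t+1}\ge P_t$) and, if $\gamma^2I>P_t$ for every $t\in\mathbb{N}_0$, converges to the unique positive definite solution $\bar P_\gamma$ of the algebraic Riccati equation $\bar P_\gamma=F_c(F_a(\bar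 P_\gamma))$. The matrices $M_k$ depend on $\gamma$ through $\bar P_\gamma$ and $F_a$. $h_\infty$ norm with evenly spaced sampling: with sampling interval $h\in\mathbb{N}$, the controller at time $t$ knows $\mathcal{J}_t=\{x_r: 0\le r\le t,\ r \text{ zero or an integer multiple of } h\}$, and a control policy $\pi_u$ is a sequence of functions $\mu_{u,t}$ with $u_t=\mu_{u,t}(\mathcal{J}_t)$; the input $u_t$ can be updated at every $t$. With $\|w\|^2=\sum_{t\ge0}w_t^\top w_t$ and $\ell_2$ the space of sequences of finite norm, $\gamma_h$ is the infimum of the $\gamma$ for which there is a $\pi_u$ such that, with $x_0=0$, $\|z\|^2\le\gamma^2\|w\|^2$ for all $w\in\ell_2$.
   Formalization: In (ii) the infimum is over γ > 0 with γ²I − M_k > 0 for all k in {1,…,h}, not only for k = h: with mere nonsingularity for k < h the claim fails at h = 3 (A = 2, B = 1, Q = R = 1, γ² = 20). *)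

theory Defs
  imports "HOL-Analysis.Analysis"
begin

(* Loewner order on real matrices. The orders (<=), (<) that the library provides on
   real^'n^'n are componentwise and are not used for matrices here. *)

definition pos_semidef :: "real^'n^'n \<Rightarrow> bool" where
  "pos_semidef X \<longleftrightarrow> transpose X = X \<and> (\<forall>v. 0 \<le> v \<bullet> (X *v v))"

definition pos_def :: "real^'n^'n \<Rightarrow> bool" where
  "pos_def X \<longleftrightarrow> transpose X = X \<and> (\<forall>v. v \<noteq> 0 \<longrightarrow> 0 < v \<bullet> (X *v v))"

definition loewner_le :: "real^'n^'n \<Rightarrow> real^'n^'n \<Rightarrow> bool" (infix \<open>\<preceq>\<close> 50) where
  "X \<preceq> Y \<longleftrightarrow> pos_semidef (Y - X)"

definition loewner_less :: "real^'n^'n \<Rightarrow> real^'n^'n \<Rightarrow> bool" (infix \<open>\<prec>\<close> 50) where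
  "X \<prec> Y \<longleftrightarrow> pos_def (Y - X)"

(* The library's (^) on real^'n^'n is the componentwise power. *)
definition mpow :: "real^'n^'n \<Rightarrow> nat \<Rightarrow> real^'n^'n" where
  "mpow A k = ((\<lambda>X. A ** X) ^^ k) (mat 1)"

(* Kalman rank conditions: [B, A B, ..., A^(n-1) B] has full row rank,
   and the stack of C, C A, ..., C A^(n-1) has full column rank. *)

definition controllable :: "real^'n^'n \<Rightarrow> real^'m^'n \<Rightarrow> bool" where
  "controllable A B \<longleftrightarrow> span (\<Union>k<CARD('n). columns (mpow A k ** B)) = UNIV"

definition observable :: "real^'n^'n \<Rightarrow> real^'n^'p \<Rightarrow> bool" where
  "observable A C \<longleftrightarrow> span (\<Union>k<CARD('n). rows (C ** mpow A k)) = UNIV"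

(* mat c is the scalar matrix c I. *)
definition F_a :: "real \<Rightarrow> real^'n^'n \<Rightarrow> real^'n^'n" where
  "F_a \<gamma> P = P + P ** matrix_inv (mat (\<gamma>\<^sup>2) - P) ** P"

definition F_c :: "real^'n^'n \<Rightarrow> real^'m^'n \<Rightarrow> real^'n^'n \<Rightarrow> real^'m^'m \<Rightarrow> real^'n^'n \<Rightarrow> real^'n^'n" where
  "F_c A B Q R P = transpose A ** P ** A + Q
     - transpose A ** P ** B ** matrix_inv (transpose B ** P ** B + R) ** transpose B ** P ** A"

definition F_o :: "real^'n^'n \<Rightarrow> real^'n^'n \<Rightarrow> real^'n^'n \<Rightarrow> real^'n^'n" where
  "F_o A Q P = transpose A ** P ** A + Q"

primrec P_seq :: "real^'n^'n \<Rightarrow> real^'m^'n \<Rightarrow> real^'n^'n \<Rightarrow> real^'m^'m \<Rightarrow> real \<Rightarrow> nat \<Rightarrow> real^'n^'n" where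
  "P_seq A B Q R \<gamma> 0 = 0"
| "P_seq A B Q R \<gamma> (Suc t) = F_c A B Q R (F_a \<gamma> (P_seq A B Q R \<gamma> t))"

(* Pbar is the positive definite solution of the Riccati equation to which the iteration
   started at 0 converges. The limit clause singles it out: for some plants and gamma the equation
   has further positive definite solutions. *)
definition is_Pbar ::
  "real^'n^'n \<Rightarrow> real^'m^'n \<Rightarrow> real^'n^'n \<Rightarrow> real^'m^'m \<Rightarrow> real \<Rightarrow> real^'n^'n \<Rightarrow> bool" where
  "is_Pbar A B Q R \<gamma> Pbar \<longleftrightarrow>
     (\<forall>t. P_seq A B Q R \<gamma> t \<prec> mat (\<gamma>\<^sup>2)) \<and>
     P_seq A B Q R \<gamma> \<longlonglongrightarrow> Pbar \<and>
     0 \<prec> Pbar \<and>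
     Pbar = F_c A B Q R (F_a \<gamma> Pbar)"

(* Indexed from k = 1, with value P there. M_seq is total; its values are meaningful only as
   long as the matrices gamma^2 I - M_j inverted on the way are nonsingular. If some
   gamma^2 I - M_j is nonsingular but not positive definite, then F_a gamma M_j is not positive
   semidefinite and a later M_k may satisfy gamma^2 I - M_k > 0 again. A condition
   gamma^2 I - M_h > 0 is therefore always imposed together with the same condition
   on M_1, ..., M_(h-1). *)
definition M_seq :: "real^'n^'n \<Rightarrow> real^'n^'n \<Rightarrow> real \<Rightarrow> real^'n^'n \<Rightarrow> nat \<Rightarrow> real^'n^'n" where
  "M_seq A Q \<gamma> P k = ((\<lambda>M. F_o A Q (F_a \<gamma> M)) ^^ (k - 1)) P"

definition in_l2 :: "(nat \<Rightarrow> real^'n) \<Rightarrow> bool" where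
  "in_l2 w \<longleftrightarrow> summable (\<lambda>t. w t \<bullet> w t)"

definition l2_normsq :: "(nat \<Rightarrow> real^'n) \<Rightarrow> real" where
  "l2_normsq w = (\<Sum>t. w t \<bullet> w t)"

(* The information available at time t: the states at the sampling times up to t. *)
definition sampled_info :: "nat \<Rightarrow> (nat \<Rightarrow> real^'n) \<Rightarrow> nat \<Rightarrow> (nat \<Rightarrow> real^'n)" where
  "sampled_info h x t = restrict x {r. r \<le> t \<and> h dvd r}"

(* For given mu and w there is exactly one such (x, u, z). *)
definition closed_loop ::
  "real^'n^'n \<Rightarrow> real^'m^'n \<Rightarrow> real^'n^'p \<Rightarrow> real^'m^'p \<Rightarrow> nat \<Rightarrow>
   (nat \<Rightarrow> (nat \<Rightarrow> real^'n) \<Rightarrow> real^'m) \<Rightarrow> (nat \<Rightarrow> real^'n) \<Rightarrow>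
   (nat \<Rightarrow> real^'n) \<Rightarrow> (nat \<Rightarrow> real^'m) \<Rightarrow> (nat \<Rightarrow> real^'p) \<Rightarrow> bool" where
  "closed_loop A B C2 D21 h \<mu> w x u z \<longleftrightarrow>
     x 0 = 0 \<and>
     (\<forall>t. x (Suc t) = A *v x t + B *v u t + w t) \<and>
     (\<forall>t. u t = \<mu> t (sampled_info h x t)) \<and>
     (\<forall>t. z t = C2 *v x t + D21 *v u t)"

definition attains_gain ::
  "real^'n^'n \<Rightarrow> real^'m^'n \<Rightarrow> real^'n^'p \<Rightarrow> real^'m^'p \<Rightarrow> nat \<Rightarrow>
   (nat \<Rightarrow> (nat \<Rightarrow> real^'n) \<Rightarrow> real^'m) \<Rightarrow> real \<Rightarrow> bool" where
  "attains_gain A B C2 D21 h \<mu> \<gamma> \<longleftrightarrow>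
     (\<forall>w x u z. in_l2 w \<longrightarrow> closed_loop A B C2 D21 h \<mu> w x u z \<longrightarrow>
        in_l2 z \<and> l2_normsq z \<le> \<gamma>\<^sup>2 * l2_normsq w)"

definition gamma_opt ::
  "real^'n^'n \<Rightarrow> real^'m^'n \<Rightarrow> real^'n^'p \<Rightarrow> real^'m^'p \<Rightarrow> nat \<Rightarrow> real" where
  "gamma_opt A B C2 D21 h = Inf {\<gamma>. 0 < \<gamma> \<and> (\<exists>\<mu>. attains_gain A B C2 D21 h \<mu> \<gamma>)}"

end

theory Submission
  imports Defs
begin

text \<open>
  Both Riccati maps are values of one-step games: \<open>F\<^sub>a\<close> is a maximum over the disturbance and
  \<open>F\<^sub>c\<close> a minimum over the input, with explicit completed squares. This makes them monotone, which
  gives (i).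

  If the conditions on \<open>M\<^sub>1, \<dots>, M\<^sub>h\<close> hold, the certainty-equivalence controller attains \<open>\<gamma>\<close>: with
  prediction error \<open>e\<close> and \<open>j\<close> steps since the last sample, the storage function
  \<open>x\<^sup>TPx + e\<^sup>T(M\<^bsub>h+1-j\<^esub> - P)e\<close> is nonnegative and dissipated, and it is unaffected by the reset
  \<open>e = 0\<close> since \<open>M\<^sub>1 = P\<close>.

  Conversely, let a controller attain \<open>\<gamma>\<close>. It applies zero input as long as it sees nothing but
  \<open>x\<^sub>0 = 0\<close>, because it must do so against \<open>w = 0\<close>. An adversary with a budget \<open>g > \<gamma>\<close> injects an
  arbitrary \<open>v\<close> at time 0 and then plays optimally, first against zero input with the weights \<open>M\<^sub>k\<close>
  and then with the finite-horizon values \<open>P\<^sub>t\<close>. This shows that all these matrices, formed for \<open>g\<close>,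
  are at most \<open>\<gamma>\<^sup>2I\<close>, so the limit \<open>P\<close> exists and all conditions hold strictly for \<open>g\<close>.

  Hence (ii), and (iii) follows because the conditions for \<open>h + 1\<close> include those for \<open>h\<close>; the infimum
  is over a nonempty set since a periodic deadbeat controller has finite gain.
\<close>

text \<open>As a simp rule it would turn \<open>transpose A *v x\<close> into \<open>x v* A\<close>
  and hide the adjoints that the inner-product rules below match.\<close>

declare transpose_matrix_vector [simp del]

subsection \<open>Quadratic forms\<close>

definition quad_form :: "real^'n^'n \<Rightarrow> real^'n \<Rightarrow> real" where
  "quad_form X v = v \<bullet> (X *v v)"

lemma inner_transpose_mult: "(transpose A *v x) \<bullet> y = x \<bullet> (A *v y)"
  for A :: "real^'m^'n"
  by (simp add: transpose_matrix_vector dot_lmul_matrix)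

lemma inner_transpose_mult_right: "y \<bullet> (transpose A *v x) = (A *v y) \<bullet> x"
  for A :: "real^'m^'n"
  by (metis inner_transpose_mult inner_commute)

lemma inner_symmetric_mult: "transpose X = X \<Longrightarrow> (X *v x) \<bullet> y = x \<bullet> (X *v y)"
  for X :: "real^'n^'n"
  by (metis inner_transpose_mult)

lemma mat_mult_vec [simp]: "mat c *v v = c *\<^sub>R v" for v :: "real^'n"
  by (simp add: vec_eq_iff mat_def matrix_vector_mult_def if_distrib[where f="\<lambda>x. x * _"] cong: if_cong)

lemma transpose_diff: "transpose (X - Y) = transpose X - transpose Y"
  for X :: "real^'n^'m"
  by (simp add: transpose_def vec_eq_iff)

lemma transpose_add: "transpose (X + Y) = transpose X + transpose Y"
  for X :: "real^'n^'m"
  by (simp add: transpose_def vec_eq_iff)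

lemma transpose_zero [simp]: "transpose 0 = (0 :: real^'n^'m)"
  by (simp add: transpose_def vec_eq_iff)

lemma transpose_congruence:
  "transpose X = X \<Longrightarrow> transpose (transpose A ** X ** A) = transpose A ** X ** A"
  for X :: "real^'n^'n" and A :: "real^'m^'n"
  by (simp add: matrix_transpose_mul matrix_mul_assoc)

lemma quad_form_add: "quad_form (X + Y) v = quad_form X v + quad_form Y v"
  by (simp add: quad_form_def algebra_simps inner_add_right)

lemma quad_form_diff: "quad_form (X - Y) v = quad_form X v - quad_form Y v"
  by (simp add: quad_form_def algebra_simps inner_diff_right)

lemma quad_form_mat: "quad_form (mat c) v = c * (v \<bullet> v)"
  by (simp add: quad_form_def)

lemma quad_form_zero [simp]: "quad_form 0 v = 0" "quad_form X 0 = 0"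
  by (simp_all add: quad_form_def)

lemma quad_form_congruence: "quad_form (transpose A ** X ** A) v = quad_form X (A *v v)"
  for A :: "real^'m^'n"
  by (simp add: quad_form_def inner_transpose_mult_right flip: matrix_vector_mul_assoc)

lemma quad_form_gram: "quad_form (transpose A ** A) v = (A *v v) \<bullet> (A *v v)"
  for A :: "real^'m^'n"
  by (simp add: quad_form_def inner_transpose_mult_right flip: matrix_vector_mul_assoc)

lemma quad_form_vec_add:
  assumes "transpose X = X"
  shows "quad_form X (v + w) = quad_form X v + 2 * (w \<bullet> (X *v v)) + quad_form X w"
  using inner_symmetric_mult[OF assms, of v w]
  by (simp add: quad_form_def algebra_simps inner_add_left inner_add_right inner_commute)

lemma pos_def_iff: "pos_def X \<longleftrightarrow> transpose X = X \<and> (\<forall>v. v \<noteq> 0 \<longrightarrow> 0 < quad_form X v)"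
  by (simp add: pos_def_def quad_form_def)

lemma pos_semidef_iff: "pos_semidef X \<longleftrightarrow> transpose X = X \<and> (\<forall>v. 0 \<le> quad_form X v)"
  by (simp add: pos_semidef_def quad_form_def)

lemma pos_def_imp_pos_semidef: "pos_def X \<Longrightarrow> pos_semidef X"
  unfolding pos_def_iff pos_semidef_iff by (metis quad_form_zero(2) less_imp_le order_refl)

lemma transpose_mat_diff_iff: "transpose (mat c - X) = mat c - X \<longleftrightarrow> transpose X = X"
  for X :: "real^'n^'n"
  by (auto simp: transpose_diff)

text \<open>The kernel is trivial because the form vanishes on it, so a left inverse exists, and for
  square matrices it is two-sided. This pins down \<open>matrix_inv\<close>, a choice among
  two-sided inverses.\<close>

lemma pos_def_invertible:
  fixes X :: "real^'n^'n"
  assumes "pos_def X"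
  shows "matrix_inv X ** X = mat 1" "X ** matrix_inv X = mat 1"
proof -
  have "\<forall>v. X *v v = 0 \<longrightarrow> v = 0"
    using assms unfolding pos_def_def by (metis inner_zero_right less_irrefl)
  then obtain Y where Y: "Y ** X = mat 1"
    using matrix_left_invertible_ker[of X] by blast
  then have "X ** Y = mat 1"
    using matrix_left_right_inverse by blast
  with Y have "X ** matrix_inv X = mat 1 \<and> matrix_inv X ** X = mat 1"
    unfolding matrix_inv_def by (metis (mono_tags, lifting) someI_ex)
  then show "matrix_inv X ** X = mat 1" "X ** matrix_inv X = mat 1" by auto
qed

lemma pos_def_matrix_inv_vec:
  fixes X :: "real^'n^'n"
  assumes "pos_def X"
  shows "X *v (matrix_inv X *v v) = v" "matrix_inv X *v (X *v v) = v"
  using pos_def_invertible[OF assms] by (simp_all add: matrix_vector_mul_assoc)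

lemma matrix_inv_symmetric:
  fixes X :: "real^'n^'n"
  assumes "pos_def X"
  shows "transpose (matrix_inv X) = matrix_inv X"
proof -
  have "transpose (matrix_inv X) ** X = transpose (X ** matrix_inv X)"
    using assms by (simp add: matrix_transpose_mul pos_def_iff)
  then have "transpose (matrix_inv X) ** X = mat 1"
    by (simp add: pos_def_invertible[OF assms])
  then have "transpose (matrix_inv X) ** X ** matrix_inv X = matrix_inv X"
    by simp
  then show ?thesis
    by (simp add: pos_def_invertible[OF assms] flip: matrix_mul_assoc)
qed

text \<open>Serves both games, for the disturbance after a change of sign. The minimiser is
  \<open>u = - (matrix_inv S *v b)\<close>.\<close>

lemma complete_square:
  assumes "pos_def S"
  shows "2 * (u \<bullet> b) + quad_form S u
    = quad_form S (u + matrix_inv S *v b) - b \<bullet> (matrix_inv S *v b)"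
proof -
  have S: "transpose S = S" using assms by (simp add: pos_def_iff)
  have "(matrix_inv S *v b) \<bullet> (S *v u) = b \<bullet> u"
    by (metis S inner_symmetric_mult pos_def_matrix_inv_vec(1)[OF assms])
  then show ?thesis
    using inner_symmetric_mult[OF S, of u "matrix_inv S *v b"]
    by (simp add: quad_form_vec_add[OF S]) (simp add: quad_form_def pos_def_matrix_inv_vec[OF assms] inner_commute)
qed

subsection \<open>The Riccati maps as values of one-step games\<close>

text \<open>Applied to \<open>v\<close>, this is the maximiser over \<open>w\<close> of
  \<open>quad_form M (v + w) - \<gamma>\<^sup>2 * (w \<bullet> w)\<close>, provided that
  \<open>mat (\<gamma>\<^sup>2) - M\<close> is positive definite.\<close>

definition dist_gain :: "real \<Rightarrow> real^'n^'n \<Rightarrow> real^'n^'n" where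
  "dist_gain \<gamma> M = matrix_inv (mat (\<gamma>\<^sup>2) - M) ** M"

text \<open>Completing the square in \<open>w\<close>. The exact remainder is kept because it
  cancels later in \<open>storage_step\<close>.\<close>

lemma F_a_square:
  assumes pd: "pos_def (mat (\<gamma>\<^sup>2) - M)"
  shows "quad_form M (v + w) - \<gamma>\<^sup>2 * (w \<bullet> w)
    = quad_form (F_a \<gamma> M) v - quad_form (mat (\<gamma>\<^sup>2) - M) (w - dist_gain \<gamma> M *v v)"
proof -
  have M: "transpose M = M"
    using pd by (simp add: pos_def_iff transpose_mat_diff_iff)
  have "quad_form (F_a \<gamma> M) v
      = quad_form M v + (M *v v) \<bullet> (matrix_inv (mat (\<gamma>\<^sup>2) - M) *v (M *v v))"
    by (simp add: F_a_def quad_form_add)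
      (simp add: quad_form_def inner_symmetric_mult[OF M] flip: matrix_vector_mul_assoc)
  then show ?thesis
    using complete_square[OF pd, of w "- (M *v v)"]
    by (simp add: quad_form_vec_add[OF M] quad_form_diff[of "mat (\<gamma>\<^sup>2)" M w] quad_form_mat
        dist_gain_def linear_neg flip: matrix_vector_mul_assoc)
qed

lemma F_a_upper:
  assumes "pos_def (mat (\<gamma>\<^sup>2) - M)"
  shows "quad_form M (v + w) - \<gamma>\<^sup>2 * (w \<bullet> w) \<le> quad_form (F_a \<gamma> M) v"
  using F_a_square[OF assms] pos_def_imp_pos_semidef[OF assms] by (simp add: pos_semidef_iff)

lemma F_a_attained:
  assumes "pos_def (mat (\<gamma>\<^sup>2) - M)"
  shows "quad_form M (v + dist_gain \<gamma> M *v v) - \<gamma>\<^sup>2 * ((dist_gain \<gamma> M *v v) \<bullet> (dist_gain \<gamma> M *v v))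
    = quad_form (F_a \<gamma> M) v"
  using F_a_square[OF assms] by simp

lemma F_a_increasing:
  assumes "pos_def (mat (\<gamma>\<^sup>2) - M)"
  shows "quad_form M v \<le> quad_form (F_a \<gamma> M) v"
  using F_a_upper[OF assms, of v 0] by simp

text \<open>The disturbance that is optimal for \<open>M\<close> is one of the choices for
  \<open>N\<close>.\<close>

lemma F_a_mono:
  assumes "pos_def (mat (\<gamma>\<^sup>2) - M)" "pos_def (mat (\<gamma>\<^sup>2) - N)"
    and "\<And>v. quad_form M v \<le> quad_form N v"
  shows "quad_form (F_a \<gamma> M) v \<le> quad_form (F_a \<gamma> N) v"
proof -
  let ?w = "dist_gain \<gamma> M *v v"
  have "quad_form (F_a \<gamma> M) v = quad_form M (v + ?w) - \<gamma>\<^sup>2 * (?w \<bullet> ?w)"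
    using F_a_attained[OF assms(1)] by simp
  also have "\<dots> \<le> quad_form N (v + ?w) - \<gamma>\<^sup>2 * (?w \<bullet> ?w)"
    using assms(3) by simp
  also have "\<dots> \<le> quad_form (F_a \<gamma> N) v"
    by (rule F_a_upper[OF assms(2)])
  finally show ?thesis .
qed

lemma F_a_symmetric:
  assumes "pos_def (mat (\<gamma>\<^sup>2) - M)"
  shows "transpose (F_a \<gamma> M) = F_a \<gamma> M"
proof -
  have "transpose M = M"
    using assms by (simp add: pos_def_iff transpose_mat_diff_iff)
  then show ?thesis
    by (simp add: F_a_def transpose_add matrix_transpose_mul matrix_inv_symmetric[OF assms] matrix_mul_assoc)
qed

lemma F_a_pos_semidef:
  assumes "pos_def (mat (\<gamma>\<^sup>2) - M)" "pos_semidef M"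
  shows "pos_semidef (F_a \<gamma> M)"
  using F_a_symmetric[OF assms(1)] F_a_increasing[OF assms(1)] assms(2)
  unfolding pos_semidef_iff by (meson order_trans)

lemma quad_form_F_o: "quad_form (F_o A Q X) x = quad_form X (A *v x) + quad_form Q x"
  by (simp add: F_o_def quad_form_add quad_form_congruence)

lemma F_o_pos_semidef:
  "pos_semidef X \<Longrightarrow> pos_semidef Q \<Longrightarrow> pos_semidef (F_o A Q X)"
  by (simp add: pos_semidef_iff quad_form_F_o) (simp add: F_o_def transpose_add transpose_congruence)

section \<open>Minimisation over the input\<close>

definition ctrl_weight :: "real^'m^'n \<Rightarrow> real^'m^'m \<Rightarrow> real^'n^'n \<Rightarrow> real^'m^'m" where
  "ctrl_weight B R X = transpose B ** X ** B + R"

text \<open>The optimal input at \<open>x\<close> is minus this gain applied to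
  \<open>x\<close>.\<close>

definition ctrl_gain :: "real^'n^'n \<Rightarrow> real^'m^'n \<Rightarrow> real^'m^'m \<Rightarrow> real^'n^'n \<Rightarrow> real^'n^'m" where
  "ctrl_gain A B R X = matrix_inv (ctrl_weight B R X) ** (transpose B ** X ** A)"

lemma quad_form_ctrl_weight: "quad_form (ctrl_weight B R X) u = quad_form X (B *v u) + quad_form R u"
  by (simp add: ctrl_weight_def quad_form_add quad_form_congruence)

lemma ctrl_weight_pos_def:
  assumes "pos_def R" "pos_semidef X"
  shows "pos_def (ctrl_weight B R X)"
proof -
  have "transpose (ctrl_weight B R X) = ctrl_weight B R X"
    using assms by (simp add: ctrl_weight_def transpose_add transpose_congruence pos_def_iff pos_semidef_iff)
  then show ?thesis
    using assms by (simp add: pos_def_iff pos_semidef_iff quad_form_ctrl_weight add_nonneg_pos)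
qed

text \<open>Completing the square in \<open>u\<close>, whose linear term is \<open>?b\<close> and
  whose weight is \<open>ctrl_weight B R X\<close>.\<close>

lemma F_c_square:
  assumes "pos_def R" "pos_semidef X"
  shows "quad_form Q x + quad_form R u + quad_form X (A *v x + B *v u)
    = quad_form (F_c A B Q R X) x + quad_form (ctrl_weight B R X) (u + ctrl_gain A B R X *v x)"
proof -
  have X: "transpose X = X"
    using assms by (simp add: pos_semidef_iff)
  let ?b = "transpose B *v (X *v (A *v x))"
  have "quad_form (F_c A B Q R X) x = quad_form X (A *v x) + quad_form Q x
      - ?b \<bullet> (matrix_inv (ctrl_weight B R X) *v ?b)"
    by (simp add: F_c_def quad_form_add quad_form_diff quad_form_congruence)
      (simp add: quad_form_def inner_transpose_mult inner_transpose_mult_right inner_symmetric_mult[OF X]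
        ctrl_weight_def flip: matrix_vector_mul_assoc)
  moreover have "(B *v u) \<bullet> (X *v (A *v x)) = u \<bullet> ?b"
    by (simp add: inner_transpose_mult_right)
  ultimately show ?thesis
    using complete_square[OF ctrl_weight_pos_def[OF assms, of B], of u ?b]
      quad_form_vec_add[OF X, of "A *v x" "B *v u"] quad_form_ctrl_weight[of B R X u]
    by (simp add: ctrl_gain_def flip: matrix_vector_mul_assoc)
qed

lemma F_c_lower:
  assumes "pos_def R" "pos_semidef X"
  shows "quad_form (F_c A B Q R X) x \<le> quad_form Q x + quad_form R u + quad_form X (A *v x + B *v u)"
  using F_c_square[OF assms, of Q x u A B] pos_def_imp_pos_semidef[OF ctrl_weight_pos_def[OF assms, of B]]
  by (simp add: pos_semidef_iff)

lemma F_c_attained: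
  fixes A :: "real^'n^'n" and B :: "real^'m^'n"
  assumes "pos_def R" "pos_semidef X"
  obtains u where "quad_form (F_c A B Q R X) x
    = quad_form Q x + quad_form R u + quad_form X (A *v x + B *v u)"
  using that[of "- (ctrl_gain A B R X *v x)"]
    F_c_square[OF assms, of Q x "- (ctrl_gain A B R X *v x)" A B] by simp

lemma F_c_symmetric:
  assumes "pos_def R" "pos_semidef X" "transpose Q = Q"
  shows "transpose (F_c A B Q R X) = F_c A B Q R X"
proof -
  have "transpose X = X"
    using assms by (simp add: pos_semidef_iff)
  moreover have "transpose (matrix_inv (transpose B ** X ** B + R)) = matrix_inv (transpose B ** X ** B + R)"
    using matrix_inv_symmetric[OF ctrl_weight_pos_def[OF assms(1,2), of B]] by (simp add: ctrl_weight_def)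
  ultimately show ?thesis
    using assms(3)
    by (simp add: F_c_def transpose_add transpose_diff matrix_transpose_mul matrix_mul_assoc)
qed

text \<open>The input that is optimal for \<open>Y\<close> is one of the choices for
  \<open>X\<close>.\<close>

lemma F_c_mono:
  fixes A :: "real^'n^'n" and B :: "real^'m^'n"
  assumes "pos_def R" "pos_semidef X" "pos_semidef Y"
    and "\<And>v. quad_form X v \<le> quad_form Y v"
  shows "quad_form (F_c A B Q R X) x \<le> quad_form (F_c A B Q R Y) x"
proof -
  obtain u where u: "quad_form (F_c A B Q R Y) x
    = quad_form Q x + quad_form R u + quad_form Y (A *v x + B *v u)"
    using F_c_attained[OF assms(1,3)] by blast
  show ?thesis
    unfolding u using F_c_lower[OF assms(1,2), of A B Q x u] assms(4)[of "A *v x + B *v u"] by simp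
qed

lemma F_c_pos_semidef:
  fixes A :: "real^'n^'n" and B :: "real^'m^'n"
  assumes "pos_def R" "pos_semidef X" "pos_semidef Q"
  shows "pos_semidef (F_c A B Q R X)"
proof -
  have "0 \<le> quad_form (F_c A B Q R X) x" for x
  proof -
    obtain u where "quad_form (F_c A B Q R X) x
        = quad_form Q x + quad_form R u + quad_form X (A *v x + B *v u)"
      using F_c_attained[OF assms(1,2)] by blast
    then show ?thesis
      using assms pos_def_imp_pos_semidef[OF assms(1)] by (simp add: pos_semidef_iff)
  qed
  then show ?thesis
    using F_c_symmetric[OF assms(1,2)] assms(3) by (simp add: pos_semidef_iff)
qed

text \<open>\<open>F_o\<close> is the cost of the choice \<open>u = 0\<close>.\<close>

lemma F_c_le_F_o:
  assumes "pos_def R" "pos_semidef X"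
  shows "quad_form (F_c A B Q R X) x \<le> quad_form (F_o A Q X) x"
  using F_c_lower[OF assms, of A B Q x 0] by (simp add: quad_form_F_o)

text \<open>Turns the nonstrict bounds that an attained gain yields into strict conditions at any
  larger level.\<close>

lemma pos_def_mat_diff_if_le:
  assumes "transpose X = X" "\<And>v. quad_form X v \<le> g * (v \<bullet> v)" "g < c"
  shows "pos_def (mat c - X)"
proof -
  have "0 < c * (v \<bullet> v) - quad_form X v" if "v \<noteq> 0" for v
  proof -
    have "g * (v \<bullet> v) < c * (v \<bullet> v)"
      using assms(3) that by (intro mult_strict_right_mono) auto
    then show ?thesis
      using assms(2)[of v] by linarith
  qed
  then show ?thesis
    using assms(1) by (simp add: pos_def_iff transpose_mat_diff_iff quad_form_diff quad_form_mat)
qed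

section \<open>Order properties of the two iterations\<close>

lemma M_seq_1 [simp]: "M_seq A Q \<gamma> P (Suc 0) = P"
  by (simp add: M_seq_def)

lemma M_seq_Suc: "1 \<le> k \<Longrightarrow> M_seq A Q \<gamma> P (Suc k) = F_o A Q (F_a \<gamma> (M_seq A Q \<gamma> P k))"
  by (cases k) (simp_all add: M_seq_def)

lemma M_seq_pos_semidef:
  assumes "pos_semidef P" "pos_semidef Q"
    and "\<And>j. 1 \<le> j \<Longrightarrow> j < k \<Longrightarrow> pos_def (mat (\<gamma>\<^sup>2) - M_seq A Q \<gamma> P j)"
    and "1 \<le> k"
  shows "pos_semidef (M_seq A Q \<gamma> P k)"
  using assms(4,3)
proof (induction k rule: dec_induct)
  case base
  then show ?case using assms(1) by simp
next
  case (step k)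
  then show ?case
    using assms(2) by (simp add: M_seq_Suc F_o_pos_semidef F_a_pos_semidef)
qed

text \<open>The start is \<open>P = F_c (F_a P) \<le> F_o (F_a P)\<close>, since giving up control
  cannot lower the cost; monotonicity of \<open>F_a\<close> and \<open>F_o\<close> propagates
  it.\<close>

lemma M_seq_mono_step:
  assumes R: "pos_def R" and P: "pos_semidef P" and ric: "P = F_c A B Q R (F_a \<gamma> P)"
    and pd: "\<And>j. 1 \<le> j \<Longrightarrow> j \<le> k \<Longrightarrow> pos_def (mat (\<gamma>\<^sup>2) - M_seq A Q \<gamma> P j)"
    and "1 \<le> k"
  shows "quad_form (M_seq A Q \<gamma> P k) v \<le> quad_form (M_seq A Q \<gamma> P (Suc k)) v"
  using \<open>1 \<le> k\<close> pd
proof (induction k arbitrary: v rule: dec_induct)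
  case base
  have "pos_semidef (F_a \<gamma> P)"
    using base[of 1] P by (intro F_a_pos_semidef) simp_all
  then have "quad_form P v \<le> quad_form (F_o A Q (F_a \<gamma> P)) v"
    using F_c_le_F_o[OF R, of "F_a \<gamma> P" A B Q v] ric by simp
  then show ?case by (simp add: M_seq_Suc)
next
  case (step k)
  have "quad_form (F_a \<gamma> (M_seq A Q \<gamma> P k)) y \<le> quad_form (F_a \<gamma> (M_seq A Q \<gamma> P (Suc k))) y" for y
    using step by (intro F_a_mono) simp_all
  then show ?case
    using step.hyps by (simp add: M_seq_Suc quad_form_F_o)
qed

text \<open>Makes the storage function of the sufficiency proof nonnegative.\<close>

lemma M_seq_ge_start:
  assumes "pos_def R" "pos_semidef P" "P = F_c A B Q R (F_a \<gamma> P)"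
    and "\<And>j. 1 \<le> j \<Longrightarrow> j < k \<Longrightarrow> pos_def (mat (\<gamma>\<^sup>2) - M_seq A Q \<gamma> P j)"
    and "1 \<le> k"
  shows "quad_form P v \<le> quad_form (M_seq A Q \<gamma> P k) v"
  using \<open>1 \<le> k\<close> assms(4)
proof (induction k rule: dec_induct)
  case base
  then show ?case by simp
next
  case (step k)
  have "quad_form P v \<le> quad_form (M_seq A Q \<gamma> P k) v"
    using step by simp
  also have "\<dots> \<le> quad_form (M_seq A Q \<gamma> P (Suc k)) v"
    using step by (intro M_seq_mono_step[OF assms(1-3)]) auto
  finally show ?case .
qed

lemma P_seq_pos_semidef:
  assumes "pos_def R" "pos_semidef Q"
    and "\<And>s. s < t \<Longrightarrow> pos_def (mat (\<gamma>\<^sup>2) - P_seq A B Q R \<gamma> s)"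
  shows "pos_semidef (P_seq A B Q R \<gamma> t)"
  using assms(3)
proof (induction t)
  case 0
  then show ?case by (simp add: pos_semidef_iff)
next
  case (Suc t)
  then show ?case
    using assms(1,2) by (simp add: F_c_pos_semidef F_a_pos_semidef)
qed

text \<open>The iteration starts at the least positive semidefinite matrix, and both maps preserve
  the order.\<close>

lemma P_seq_mono_step:
  fixes A :: "real^'n^'n" and B :: "real^'m^'n"
  assumes "pos_def R" "pos_semidef Q"
    and "\<And>s. s \<le> t \<Longrightarrow> pos_def (mat (\<gamma>\<^sup>2) - P_seq A B Q R \<gamma> s)"
  shows "quad_form (P_seq A B Q R \<gamma> t) v \<le> quad_form (P_seq A B Q R \<gamma> (Suc t)) v"
  using assms(3)
proof (induction t arbitrary: v)
  case 0
  have "pos_semidef (P_seq A B Q R \<gamma> (Suc 0))"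
    using 0 by (intro P_seq_pos_semidef assms(1,2)) simp
  then show ?case by (simp add: pos_semidef_iff)
next
  case (Suc t)
  have psd: "pos_semidef (P_seq A B Q R \<gamma> s)" if "s \<le> Suc t" for s
    using Suc.prems that by (intro P_seq_pos_semidef assms(1,2)) simp
  have "quad_form (F_a \<gamma> (P_seq A B Q R \<gamma> t)) y \<le> quad_form (F_a \<gamma> (P_seq A B Q R \<gamma> (Suc t))) y" for y
    using Suc Suc.prems[of "Suc t"] by (intro F_a_mono) (simp_all del: P_seq.simps(2))
  moreover have "pos_semidef (F_a \<gamma> (P_seq A B Q R \<gamma> s))" if "s \<le> Suc t" for s
    using Suc.prems psd that by (intro F_a_pos_semidef) blast+
  ultimately show ?case
    unfolding P_seq.simps(2) by (intro F_c_mono assms(1)) (simp_all flip: P_seq.simps(2))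
qed

subsection \<open>Closed loops against feedback disturbances\<close>

text \<open>Course-of-values recursion: the next state may depend on the whole past, as the input
  does through all samples.\<close>

lemma causal_recursion: "\<exists>x. x 0 = a \<and> (\<forall>t. x (Suc t) = f t (restrict x {..t}))"
proof -
  \<comment> \<open>\<open>H t\<close> is the history up to time \<open>t\<close> and
    \<open>undefined\<close> afterwards, so that it equals a restricted trajectory as a
    function.\<close>
  define H where "H = rec_nat ((\<lambda>_. undefined)(0 := a)) (\<lambda>t g. g(Suc t := f t g))"
  have H0: "H 0 = (\<lambda>_. undefined)(0 := a)" and HS: "H (Suc t) = (H t)(Suc t := f t (H t))" for t
    by (simp_all add: H_def)
  have later: "H t s = undefined" if "t < s" for s t
    using that by (induction t) (auto simp: H0 HS)
  have stable: "H (s + k) s = H s s" for s k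
    by (induction k) (simp_all add: HS)
  have "restrict (\<lambda>r. H r r) {..t} = H t" for t
  proof
    fix s
    show "restrict (\<lambda>r. H r r) {..t} s = H t s"
      using later[of t s] stable[of s "t - s"] by (cases "s \<le> t") auto
  qed
  then show ?thesis
    by (intro exI[of _ "\<lambda>r. H r r"]) (simp add: H0 HS)
qed

lemma sampled_info_restrict: "sampled_info h (restrict x {..t}) t = sampled_info h x t"
  by (auto simp: sampled_info_def restrict_def)

text \<open>A disturbance may react to \<open>A x + B u\<close>: the policy is deterministic, so the
  reaction produces one fixed sequence \<open>w\<close>, to which a gain bound can be
  applied.\<close>

lemma closed_loop_feedback_exists:
  "\<exists>w x u z. closed_loop A B C2 D21 h \<mu> w x u z \<and> (\<forall>t. w t = W t (A *v x t + B *v u t))"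
proof -
  \<comment> \<open>The trajectory enters only through \<open>x t\<close> and the samples up to
    \<open>t\<close>, so cutting it off after \<open>t\<close> changes nothing.\<close>
  define next_state where "next_state = (\<lambda>t x.
    let y = A *v x t + B *v \<mu> t (sampled_info h x t) in y + W t y)"
  obtain x where x: "x 0 = 0" "\<And>t. x (Suc t) = next_state t (restrict x {..t})"
    using causal_recursion[of 0 next_state] by blast
  define u where "u = (\<lambda>t. \<mu> t (sampled_info h x t))"
  have "x (Suc t) = A *v x t + B *v u t + W t (A *v x t + B *v u t)" for t
    unfolding x(2) next_state_def Let_def sampled_info_restrict by (simp add: u_def)
  then show ?thesis
    using x(1)
    by (intro exI[of _ "\<lambda>t. W t (A *v x t + B *v u t)"] exI[of _ x] exI[of _ u]
        exI[of _ "\<lambda>t. C2 *v x t + D21 *v u t"]) (simp add: closed_loop_def u_def)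
qed

lemma l2_finite_support:
  assumes "\<And>t. T \<le> t \<Longrightarrow> w t = 0"
  shows "in_l2 w" "l2_normsq w = (\<Sum>t<T. w t \<bullet> w t)"
proof -
  have "(\<lambda>t. w t \<bullet> w t) sums (\<Sum>t<T. w t \<bullet> w t)"
    using assms by (intro sums_finite) auto
  then show "in_l2 w" "l2_normsq w = (\<Sum>t<T. w t \<bullet> w t)"
    by (auto simp: in_l2_def l2_normsq_def sums_iff)
qed

lemma sum_le_l2_normsq: "in_l2 z \<Longrightarrow> (\<Sum>t<T. z t \<bullet> z t) \<le> l2_normsq z"
  unfolding in_l2_def l2_normsq_def by (intro sum_le_suminf) auto

subsection \<open>The adversary\<close>

locale plant =
  fixes A :: "real^'n^'n" and B :: "real^'m^'n"
    and C2 :: "real^'n^'p" and D21 :: "real^'m^'p"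
    and Q :: "real^'n^'n" and R :: "real^'m^'m"
  assumes orth: "transpose C2 ** D21 = 0"
    and Q_eq: "Q = transpose C2 ** C2"
    and R_eq: "R = transpose D21 ** D21"
    and R_pos_def: "pos_def R"
    and ctrl: "controllable A B"
    and obs: "observable A C2"
begin

abbreviation "P \<equiv> P_seq A B Q R"

lemma Q_pos_semidef: "pos_semidef Q"
  by (simp add: Q_eq pos_semidef_iff quad_form_gram matrix_transpose_mul)

lemma output_normsq: "(C2 *v x + D21 *v u) \<bullet> (C2 *v x + D21 *v u) = quad_form Q x + quad_form R u"
proof -
  have "(C2 *v x) \<bullet> (D21 *v u) = x \<bullet> ((transpose C2 ** D21) *v u)"
    by (simp add: inner_transpose_mult_right flip: matrix_vector_mul_assoc)
  then show ?thesis
    by (simp add: orth Q_eq R_eq quad_form_gram inner_add_left inner_add_right inner_commute)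
qed

text \<open>Against \<open>w = 0\<close> the gain bound forces \<open>z = 0\<close>, positive
  definiteness of \<open>R\<close> then forces \<open>u = 0\<close>, and the state stays at
  0.\<close>

lemma undisturbed_inputs_zero:
  assumes \<mu>: "attains_gain A B C2 D21 h \<mu> \<gamma>"
  shows "\<mu> t (sampled_info h (\<lambda>_. 0) t) = 0"
proof -
  obtain w x u z where cl: "closed_loop A B C2 D21 h \<mu> w x u z" and w: "\<And>t. w t = 0"
    using closed_loop_feedback_exists[where W = "\<lambda>_ _. 0"] by blast
  have "in_l2 w" "l2_normsq w = 0"
    using l2_finite_support[of 0 w] w by simp_all
  with \<mu> cl have z: "in_l2 z" "l2_normsq z \<le> 0"
    unfolding attains_gain_def by fastforce+
  have "u t = 0" for t
  proof -
    have "z t \<bullet> z t \<le> (\<Sum>s<Suc t. z s \<bullet> z s)"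
      by (intro member_le_sum) auto
    also have "\<dots> \<le> 0"
      using sum_le_l2_normsq[OF z(1), of "Suc t"] z(2) by linarith
    finally have "quad_form Q (x t) + quad_form R (u t) \<le> 0"
      using cl by (simp add: closed_loop_def output_normsq)
    then have "quad_form R (u t) \<le> 0"
      using Q_pos_semidef by (smt (verit) pos_semidef_iff)
    then show ?thesis
      using R_pos_def by (meson pos_def_iff not_le)
  qed
  moreover have "x t = 0" for t
    using cl w calculation by (induction t) (simp_all add: closed_loop_def)
  then have "x = (\<lambda>_. 0)" by auto
  ultimately show ?thesis
    using cl by (metis closed_loop_def)
qed

text \<open>The only sampling time before \<open>h\<close> is 0, where the state is 0, so the policy
  sees the undisturbed history.\<close>

lemma blind_inputs_zero:
  assumes \<mu>: "attains_gain A B C2 D21 h \<mu> \<gamma>"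
    and cl: "closed_loop A B C2 D21 h \<mu> w x u z" and "t < h"
  shows "u t = 0"
proof -
  have "r = 0" if "r \<le> t" "h dvd r" for r
    using that \<open>t < h\<close> by (meson dvd_imp_le le_less_trans not_gr0 not_less)
  then have "sampled_info h x t = sampled_info h (\<lambda>_. 0) t"
    using cl by (intro ext) (auto simp: sampled_info_def restrict_def closed_loop_def)
  then show ?thesis
    using cl undisturbed_inputs_zero[OF \<mu>] by (metis closed_loop_def)
qed

text \<open>The adversary injects \<open>v\<close> at time 0 and then plays the disturbances that are optimal for the
  value functions \<open>X\<close>; the controller sees none of this before time \<open>h\<close>.\<close>

lemma adversary_bound:
  assumes \<mu>: "attains_gain A B C2 D21 h \<mu> \<gamma>" and h: "1 \<le> h"
    and g: "\<gamma>\<^sup>2 \<le> g\<^sup>2" and T: "1 \<le> T" and XT: "X T = 0"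
    and pd: "\<And>t. 1 \<le> t \<Longrightarrow> t < T \<Longrightarrow> pos_def (mat (g\<^sup>2) - X (Suc t))"
    and X: "\<And>t x u. 1 \<le> t \<Longrightarrow> t < T \<Longrightarrow> (t < h \<Longrightarrow> u = 0) \<Longrightarrow>
      quad_form (X t) x \<le> quad_form Q x + quad_form R u + quad_form (F_a g (X (Suc t))) (A *v x + B *v u)"
  shows "quad_form (X 1) v \<le> \<gamma>\<^sup>2 * (v \<bullet> v)"
proof -
  \<comment> \<open>Vanishing from \<open>T\<close> on gives the disturbance finite norm.\<close>
  define W where "W = (\<lambda>t y. if t = 0 then v else if t < T then dist_gain g (X (Suc t)) *v y else 0)"
  obtain w x u z where cl: "closed_loop A B C2 D21 h \<mu> w x u z"
    and w: "\<And>t. w t = W t (A *v x t + B *v u t)"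
    using closed_loop_feedback_exists[where W = W] by blast
  have x: "x 0 = 0" "x (Suc t) = A *v x t + B *v u t + w t" for t
    using cl by (simp_all add: closed_loop_def)
  have zz: "z t \<bullet> z t = quad_form Q (x t) + quad_form R (u t)" for t
    using cl by (simp add: closed_loop_def output_normsq)
  have u: "u t = 0" if "t < h" for t
    using blind_inputs_zero[OF \<mu> cl that] .
  have w0: "w 0 = v" by (simp add: w W_def)
  have supp: "w t = 0" if "T \<le> t" for t
    using that T by (simp add: w W_def)
  have z0: "z 0 = 0"
    using zz[of 0] u[of 0] x h by simp
  have x1: "x 1 = v"
    using x(2)[of 0] x(1) u[of 0] h w0 by simp
  \<comment> \<open>The sum starts at time 1: \<open>z 0 = 0\<close>, and the price of
    \<open>v\<close> is accounted for separately.\<close>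
  have tele: "quad_form (X 1) v \<le> (\<Sum>t=1..<n. z t \<bullet> z t - g\<^sup>2 * (w t \<bullet> w t)) + quad_form (X n) (x n)"
    if "1 \<le> n" "n \<le> T" for n
    using that
  proof (induction n rule: dec_induct)
    case base
    then show ?case by (simp add: x1 [simplified])
  next
    case (step n)
    have wn: "w n = dist_gain g (X (Suc n)) *v (A *v x n + B *v u n)"
      using step by (simp add: w W_def)
    have "quad_form (X n) (x n) \<le> quad_form Q (x n) + quad_form R (u n)
        + quad_form (F_a g (X (Suc n))) (A *v x n + B *v u n)"
      using step u by (intro X) auto
    also have "\<dots> = z n \<bullet> z n - g\<^sup>2 * (w n \<bullet> w n) + quad_form (X (Suc n)) (x (Suc n))"
      using F_a_attained[OF pd, of n "A *v x n + B *v u n"] step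
      by (simp add: zz x(2) flip: wn)
    finally show ?case
      using step by simp
  qed
  have "in_l2 z" "l2_normsq z \<le> \<gamma>\<^sup>2 * l2_normsq w"
    using \<mu> cl l2_finite_support(1)[of T w, OF supp] unfolding attains_gain_def by blast+
  then have "(\<Sum>t<T. z t \<bullet> z t) \<le> \<gamma>\<^sup>2 * (\<Sum>t<T. w t \<bullet> w t)"
    using sum_le_l2_normsq[of z T] l2_finite_support(2)[OF supp] by simp
  then have "(\<Sum>t=1..<T. z t \<bullet> z t) \<le> \<gamma>\<^sup>2 * (v \<bullet> v) + \<gamma>\<^sup>2 * (\<Sum>t=1..<T. w t \<bullet> w t)"
    using T z0 w0 by (simp add: lessThan_atLeast0 sum.atLeast_Suc_lessThan distrib_left)
  \<comment> \<open>Raising the rate of the later disturbances to \<open>g\<^sup>2\<close> makes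
    them cancel; only \<open>v\<close> remains, at the sharper rate
    \<open>\<gamma>\<^sup>2\<close>.\<close>
  moreover have "\<gamma>\<^sup>2 * (\<Sum>t=1..<T. w t \<bullet> w t) \<le> g\<^sup>2 * (\<Sum>t=1..<T. w t \<bullet> w t)"
    using g by (intro mult_right_mono sum_nonneg) auto
  ultimately show ?thesis
    using tele[OF T order_refl] XT by (simp add: sum_subtractf sum_distrib_left)
qed

text \<open>Time 0 is spent on \<open>v\<close>, which leaves the blind times 1 to
  \<open>h - 1\<close>; hence \<open>k < h\<close>. Starting \<open>M_seq\<close> at
  \<open>P g N\<close> keeps the horizon finite, before any limit is known to exist.\<close>

lemma value_bound:
  assumes \<mu>: "attains_gain A B C2 D21 h \<mu> \<gamma>" and g: "\<gamma>\<^sup>2 \<le> g\<^sup>2" and k: "k < h"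
    and P: "\<And>s. s < N \<Longrightarrow> pos_def (mat (g\<^sup>2) - P g s)"
    and M: "\<And>j. 1 \<le> j \<Longrightarrow> j \<le> k \<Longrightarrow> pos_def (mat (g\<^sup>2) - M_seq A Q g (P g N) j)"
  shows "quad_form (M_seq A Q g (P g N) (Suc k)) v \<le> \<gamma>\<^sup>2 * (v \<bullet> v)"
proof -
  \<comment> \<open>The values are \<open>M_(k+1), ..., M_2\<close> at times 1 to \<open>k\<close>,
    then \<open>P_N, ..., P_0 = 0\<close> at times \<open>k + 1\<close> to \<open>N + k + 1\<close>.
    Since \<open>M_1 = P_N\<close>, both formulas hold at \<open>k + 1\<close>.\<close>
  define X where "X = (\<lambda>t. if t \<le> k then M_seq A Q g (P g N) (Suc (Suc k) - t) else P g (N + Suc k - t))"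
  have X_M: "X t = M_seq A Q g (P g N) (Suc (Suc k) - t)" if "t \<le> Suc k" for t
    using that by (auto simp: X_def le_Suc_eq)
  have X_P: "X t = P g (N + Suc k - t)" if "Suc k \<le> t" for t
    using that by (auto simp: X_def)
  have pd: "pos_def (mat (g\<^sup>2) - X (Suc t))" if "1 \<le> t" "t < N + Suc k" for t
  proof (cases "t \<le> k")
    case True
    then show ?thesis
      using M[of "Suc k - t"] that by (simp add: X_M)
  next
    case False
    then show ?thesis
      using P[of "N + k - t"] that by (simp add: X_P)
  qed
  have "quad_form (X 1) v \<le> \<gamma>\<^sup>2 * (v \<bullet> v)"
  proof (rule adversary_bound[OF \<mu> _ g, where T = "N + Suc k"])
    show "X (N + Suc k) = 0"
      by (simp add: X_P)
    fix t x and u :: "real^'m"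
    assume t: "1 \<le> t" "t < N + Suc k" and blind: "t < h \<Longrightarrow> u = 0"
    show "quad_form (X t) x \<le> quad_form Q x + quad_form R u + quad_form (F_a g (X (Suc t))) (A *v x + B *v u)"
    proof (cases "t \<le> k")
      case True
      then have "X t = F_o A Q (F_a g (X (Suc t)))"
        using M_seq_Suc[of "Suc k - t" A Q g "P g N"] by (simp add: X_M Suc_diff_le)
      then show ?thesis
        using True blind k by (simp add: quad_form_F_o)
    next
      case False
      then have "X t = F_c A B Q R (F_a g (P g (N + k - t)))" "X (Suc t) = P g (N + k - t)"
        using t by (simp_all add: X_P Suc_diff_le)
      moreover have "pos_semidef (F_a g (P g (N + k - t)))"
        using False t by (intro F_a_pos_semidef P P_seq_pos_semidef R_pos_def Q_pos_semidef) auto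
      ultimately show ?thesis
        using F_c_lower[OF R_pos_def] by simp
    qed
  qed (use k pd in auto)
  then show ?thesis
    by (simp add: X_M)
qed

end

subsection \<open>Convergence of matrices\<close>

lemma tendsto_matrix_vector_mult:
  fixes X :: "nat \<Rightarrow> real^'n^'m"
  assumes "X \<longlonglongrightarrow> L" "w \<longlonglongrightarrow> v"
  shows "(\<lambda>k. X k *v w k) \<longlonglongrightarrow> L *v v"
  by (rule vec_tendstoI) (auto simp: matrix_vector_mul_component intro!: tendsto_intros assms)

lemma tendsto_matrix_if_tendsto_vector:
  fixes X :: "nat \<Rightarrow> real^'n^'m"
  assumes "\<And>v. (\<lambda>k. X k *v v) \<longlonglongrightarrow> L *v v"
  shows "X \<longlonglongrightarrow> L"
proof (intro vec_tendstoI)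
  fix i j
  have "(\<lambda>k. (X k *v axis j 1) $ i) \<longlonglongrightarrow> (L *v axis j 1) $ i"
    by (intro tendsto_vec_nth assms)
  then show "(\<lambda>k. X k $ i $ j) \<longlonglongrightarrow> L $ i $ j"
    by (simp add: matrix_vector_mult_basis column_def)
qed

lemma tendsto_matrix_mult:
  fixes X :: "nat \<Rightarrow> real^'n^'m" and Y :: "nat \<Rightarrow> real^'k^'n"
  assumes "X \<longlonglongrightarrow> K" "Y \<longlonglongrightarrow> L"
  shows "(\<lambda>k. X k ** Y k) \<longlonglongrightarrow> K ** L"
  by (rule tendsto_matrix_if_tendsto_vector)
    (auto simp flip: matrix_vector_mul_assoc intro!: tendsto_matrix_vector_mult assms)

lemma tendsto_transpose:
  fixes X :: "nat \<Rightarrow> real^'n^'m"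
  assumes "X \<longlonglongrightarrow> L"
  shows "(\<lambda>k. transpose (X k)) \<longlonglongrightarrow> transpose L"
  by (intro vec_tendstoI) (auto simp: transpose_def intro!: tendsto_intros assms)

lemma tendsto_quad_form: "X \<longlonglongrightarrow> L \<Longrightarrow> (\<lambda>k. quad_form (X k) v) \<longlonglongrightarrow> quad_form L v"
  unfolding quad_form_def by (intro tendsto_intros tendsto_matrix_vector_mult)

lemma symmetric_limit:
  fixes X :: "nat \<Rightarrow> real^'n^'n"
  assumes "X \<longlonglongrightarrow> L" "\<And>k. transpose (X k) = X k"
  shows "transpose L = L"
  using tendsto_transpose[OF assms(1)] assms by (simp add: LIMSEQ_unique)

lemma pos_semidef_limit:
  assumes "X \<longlonglongrightarrow> L" "\<And>k. pos_semidef (X k)"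
  shows "pos_semidef L"
proof -
  have "0 \<le> quad_form L v" for v
    by (rule LIMSEQ_le_const[OF tendsto_quad_form[OF assms(1)]]) (use assms(2) in \<open>auto simp: pos_semidef_iff\<close>)
  then show ?thesis
    using symmetric_limit[OF assms(1)] assms(2) by (simp add: pos_semidef_iff)
qed

text \<open>Coercivity bounds all inverses by \<open>1 / c\<close>; the identity
  \<open>X_k^(-1) - L^(-1) = X_k^(-1) (L - X_k) L^(-1)\<close> does the rest.\<close>

lemma tendsto_matrix_inv:
  fixes X :: "nat \<Rightarrow> real^'n^'n"
  assumes lim: "X \<longlonglongrightarrow> L" and sym: "\<And>k. transpose (X k) = X k"
    and c: "0 < c" and coercive: "\<And>k v. c * (v \<bullet> v) \<le> quad_form (X k) v"
  shows "(\<lambda>k. matrix_inv (X k)) \<longlonglongrightarrow> matrix_inv L"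
proof (rule tendsto_matrix_if_tendsto_vector)
  fix v
  have coercive_L: "c * (v \<bullet> v) \<le> quad_form L v" for v
    by (rule LIMSEQ_le_const[OF tendsto_quad_form[OF lim]]) (use coercive in auto)
  have pdL: "pos_def L"
    using symmetric_limit[OF lim sym] c coercive_L unfolding pos_def_iff
    by (metis inner_gt_zero_iff less_le_trans mult_pos_pos)
  have pdX: "pos_def (X k)" for k
    using sym c coercive unfolding pos_def_iff
    by (metis inner_gt_zero_iff less_le_trans mult_pos_pos)
  have inv_bound: "norm (matrix_inv (X k) *v y) \<le> norm y / c" for k y
  proof (cases "matrix_inv (X k) *v y = 0")
    case False
    let ?u = "matrix_inv (X k) *v y"
    have "c * norm ?u * norm ?u \<le> ?u \<bullet> y"
      using coercive[of ?u k]
      by (simp add: quad_form_def pos_def_matrix_inv_vec[OF pdX] dot_square_norm power2_eq_square)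
    also have "\<dots> \<le> norm y * norm ?u"
      using norm_cauchy_schwarz[of ?u y] by (simp add: mult.commute)
    finally show ?thesis
      using False c by (simp add: field_simps)
  qed (use c in simp)
  let ?u = "matrix_inv L *v v"
  have "matrix_inv (X k) *v v - ?u = matrix_inv (X k) *v (L *v ?u - X k *v ?u)" for k
    by (simp add: matrix_vector_mult_diff_distrib pos_def_matrix_inv_vec[OF pdX] pos_def_matrix_inv_vec[OF pdL])
  then have bound: "norm (matrix_inv (X k) *v v - ?u) \<le> norm (L *v ?u - X k *v ?u) / c" for k
    using inv_bound[of k "L *v ?u - X k *v ?u"] by simp
  have "(\<lambda>k. norm (L *v ?u - X k *v ?u) / c) \<longlonglongrightarrow> norm (L *v ?u - L *v ?u) / c"
    using c by (intro tendsto_divide tendsto_norm tendsto_diff tendsto_const tendsto_matrix_vector_mult lim) simp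
  then have "(\<lambda>k. norm (L *v ?u - X k *v ?u) / c) \<longlonglongrightarrow> 0"
    by simp
  then have "(\<lambda>k. matrix_inv (X k) *v v - ?u) \<longlonglongrightarrow> 0"
    by (rule Lim_null_comparison[rotated]) (simp add: bound)
  then show "(\<lambda>k. matrix_inv (X k) *v v) \<longlonglongrightarrow> ?u"
    by (simp add: LIM_zero_iff)
qed

text \<open>The constant is the minimum over the compact unit sphere, extended by
  homogeneity.\<close>

lemma pos_def_coercive:
  fixes X :: "real^'n^'n"
  assumes "pos_def X"
  obtains c where "0 < c" "\<And>v. c * (v \<bullet> v) \<le> quad_form X v"
proof -
  have "continuous_on (sphere 0 1) (quad_form X)"
    unfolding quad_form_def by (intro continuous_intros matrix_vector_mult_linear_continuous_on)
  moreover have "sphere (0::real^'n) 1 \<noteq> {}"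
    by (simp add: sphere_eq_empty)
  ultimately obtain m where m: "m \<in> sphere 0 1" "\<And>v. v \<in> sphere 0 1 \<Longrightarrow> quad_form X m \<le> quad_form X v"
    using continuous_attains_inf[OF compact_sphere] by blast
  have "quad_form X m * (v \<bullet> v) \<le> quad_form X v" for v
  proof (cases "v = 0")
    case False
    then have "quad_form X m \<le> quad_form X (inverse (norm v) *\<^sub>R v)"
      by (intro m(2)) simp
    also have "\<dots> = quad_form X v / (norm v * norm v)"
      by (simp add: quad_form_def matrix_vector_mult_scaleR divide_inverse)
    finally show ?thesis
      using False by (simp add: dot_square_norm power2_eq_square pos_le_divide_eq)
  qed simp
  moreover have "0 < quad_form X m"
    using assms m(1) unfolding pos_def_iff by (metis mem_sphere_0 norm_zero zero_neq_one)
  ultimately show thesis using that by blast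
qed

text \<open>The values of the forms converge, and polarization recovers the entries from unit
  vectors and their sums.\<close>

lemma monotone_bounded_matrix_converges:
  fixes X :: "nat \<Rightarrow> real^'n^'n"
  assumes sym: "\<And>k. transpose (X k) = X k"
    and mono: "\<And>k v. quad_form (X k) v \<le> quad_form (X (Suc k)) v"
    and bdd: "\<And>k v. quad_form (X k) v \<le> b * (v \<bullet> v)"
  obtains L where "X \<longlonglongrightarrow> L"
proof -
  have "\<exists>l. (\<lambda>k. quad_form (X k) v) \<longlonglongrightarrow> l" for v
    by (rule incseq_convergent[of "\<lambda>k. quad_form (X k) v" "b * (v \<bullet> v)"])
      (use mono bdd in \<open>auto simp: incseq_Suc_iff\<close>)
  then obtain l where l: "\<And>v. (\<lambda>k. quad_form (X k) v) \<longlonglongrightarrow> l v"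
    by metis
  have entry: "X k $ i $ j = (quad_form (X k) (axis j 1 + axis i 1) - quad_form (X k) (axis j 1)
      - quad_form (X k) (axis i 1)) / 2" for k i j
    by (simp add: quad_form_vec_add[OF sym] inner_axis' matrix_vector_mult_basis column_def)
  have "X \<longlonglongrightarrow> (\<chi> i j. (l (axis j 1 + axis i 1) - l (axis j 1) - l (axis i 1)) / 2)"
    by (intro vec_tendstoI) (simp add: entry, intro tendsto_intros l, simp)
  then show thesis by (rule that)
qed

text \<open>The gap between \<open>b\<close> and \<open>g\<^sup>2\<close> makes the inverted
  matrices uniformly coercive.\<close>

lemma tendsto_F_a:
  assumes lim: "M \<longlonglongrightarrow> L" and sym: "\<And>k. transpose (M k) = M k"
    and b: "\<And>k v. quad_form (M k) v \<le> b * (v \<bullet> v)" "b < g\<^sup>2"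
  shows "(\<lambda>k. F_a g (M k)) \<longlonglongrightarrow> F_a g L"
proof -
  have "(\<lambda>k. matrix_inv (mat (g\<^sup>2) - M k)) \<longlonglongrightarrow> matrix_inv (mat (g\<^sup>2) - L)"
  proof (rule tendsto_matrix_inv[where c = "g\<^sup>2 - b"])
    show "(g\<^sup>2 - b) * (v \<bullet> v) \<le> quad_form (mat (g\<^sup>2) - M k) v" for k v
      using b(1)[of k v] by (simp add: quad_form_diff quad_form_mat algebra_simps)
  qed (use b(2) sym in \<open>auto simp: transpose_mat_diff_iff intro!: tendsto_intros lim\<close>)
  then show ?thesis
    unfolding F_a_def by (intro tendsto_add tendsto_matrix_mult lim)
qed

lemma tendsto_F_o: "X \<longlonglongrightarrow> L \<Longrightarrow> (\<lambda>k. F_o A Q (X k)) \<longlonglongrightarrow> F_o A Q L"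
  unfolding F_o_def by (intro tendsto_intros tendsto_matrix_mult)

text \<open>Here the uniform coercivity comes from \<open>R\<close>.\<close>

lemma tendsto_F_c:
  fixes A :: "real^'n^'n" and B :: "real^'m^'n"
  assumes lim: "X \<longlonglongrightarrow> L" and psd: "\<And>k. pos_semidef (X k)" and R: "pos_def R"
  shows "(\<lambda>k. F_c A B Q R (X k)) \<longlonglongrightarrow> F_c A B Q R L"
proof -
  obtain c where c: "0 < c" "\<And>v. c * (v \<bullet> v) \<le> quad_form R v"
    using pos_def_coercive[OF R] by blast
  have "(\<lambda>k. matrix_inv (ctrl_weight B R (X k))) \<longlonglongrightarrow> matrix_inv (ctrl_weight B R L)"
  proof (rule tendsto_matrix_inv[OF _ _ c(1)])
    show "(\<lambda>k. ctrl_weight B R (X k)) \<longlonglongrightarrow> ctrl_weight B R L"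
      unfolding ctrl_weight_def by (intro tendsto_intros tendsto_matrix_mult lim)
    show "transpose (ctrl_weight B R (X k)) = ctrl_weight B R (X k)" for k
      using ctrl_weight_pos_def[OF R psd] by (simp add: pos_def_iff)
    show "c * (v \<bullet> v) \<le> quad_form (ctrl_weight B R (X k)) v" for k v
      using psd[of k] c(2)[of v] by (simp add: quad_form_ctrl_weight pos_semidef_iff add_increasing)
  qed
  then show ?thesis
    unfolding F_c_def ctrl_weight_def
    by (intro tendsto_diff tendsto_add tendsto_const tendsto_matrix_mult lim)
qed

subsection \<open>Necessity\<close>

lemma mpow_0 [simp]: "mpow A 0 = mat 1"
  by (simp add: mpow_def)

lemma mpow_Suc: "mpow A (Suc k) = A ** mpow A k"
  by (simp add: mpow_def)

lemma mpow_Suc_right: "mpow A (Suc k) = mpow A k ** A"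
proof (induction k)
  case (Suc k)
  then show ?case
    by (metis mpow_Suc matrix_mul_assoc)
qed (simp add: mpow_Suc)

lemma observable_imp_zero:
  assumes "observable A C" and zero: "\<And>k. k < CARD('n) \<Longrightarrow> C *v (mpow A k *v x) = 0"
  shows "x = (0 :: real^'n)"
proof -
  have "row i (C ** mpow A k) \<bullet> x = 0" if "k < CARD('n)" for i k
  proof -
    have "row i (C ** mpow A k) \<bullet> x = ((C ** mpow A k) *v x) $ i"
      by (simp add: matrix_vector_mul_component row_def)
    then show ?thesis
      using zero[OF that] by (simp flip: matrix_vector_mul_assoc)
  qed
  then have "(\<Union>k<CARD('n). rows (C ** mpow A k)) \<subseteq> {y. y \<bullet> x = 0}"
    by (auto simp: rows_def)
  moreover have "subspace {y. y \<bullet> x = 0}"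
    by (simp add: subspace_def inner_add_left)
  ultimately have "span (\<Union>k<CARD('n). rows (C ** mpow A k)) \<subseteq> {y. y \<bullet> x = 0}"
    by (rule span_minimal)
  then have "x \<in> {y. y \<bullet> x = 0}"
    using assms(1) unfolding observable_def by blast
  then show ?thesis by simp
qed

context plant
begin

lemma quad_form_Q_eq_0: "quad_form Q x = 0 \<longleftrightarrow> C2 *v x = 0"
  by (simp add: Q_eq quad_form_gram)

text \<open>Zero optimal cost makes every summand vanish: the output is zero, \<open>R\<close>
  forces zero input, and the free successor \<open>A x\<close> again has zero cost. With
  observability this makes the limit positive definite.\<close>

lemma P_seq_eq_0_imp:
  assumes "\<And>s. s < t \<Longrightarrow> pos_def (mat (g\<^sup>2) - P g s)" "quad_form (P g t) x = 0" "k < t"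
  shows "C2 *v (mpow A k *v x) = 0"
  using assms
proof (induction t arbitrary: x k)
  case (Suc t)
  have psd: "pos_semidef (P g t)" and psd': "pos_semidef (F_a g (P g t))"
    using Suc.prems(1) by (auto intro!: F_a_pos_semidef P_seq_pos_semidef R_pos_def Q_pos_semidef)
  obtain u where u: "quad_form (P g (Suc t)) x
      = quad_form Q x + quad_form R u + quad_form (F_a g (P g t)) (A *v x + B *v u)"
    unfolding P_seq.simps(2) using F_c_attained[OF R_pos_def psd'] by blast
  have "0 \<le> quad_form Q x" "0 \<le> quad_form R u" "0 \<le> quad_form (F_a g (P g t)) (A *v x + B *v u)"
    using psd' Q_pos_semidef pos_def_imp_pos_semidef[OF R_pos_def] by (simp_all add: pos_semidef_iff)
  then have zero: "quad_form Q x = 0" "quad_form R u = 0" "quad_form (F_a g (P g t)) (A *v x + B *v u) = 0"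
    using u Suc.prems(2) by linarith+
  then have "u = 0"
    using R_pos_def by (metis pos_def_iff less_irrefl)
  then have "quad_form (P g t) (A *v x) = 0"
    using zero(3) F_a_increasing[OF Suc.prems(1), of t "A *v x"] psd
    by (simp add: pos_semidef_iff antisym)
  then show ?case
    using Suc.IH[of "A *v x" "k - 1"] Suc.prems zero(1)
    by (cases k) (auto simp: quad_form_Q_eq_0 mpow_Suc_right simp flip: matrix_vector_mul_assoc)
qed simp

text \<open>Each bound needs the strict conditions at all earlier steps and yields the next one
  through the gap between \<open>\<gamma>\<close> and \<open>g\<close>; hence the joint
  induction.\<close>

lemma P_seq_bound:
  assumes \<mu>: "attains_gain A B C2 D21 h \<mu> \<gamma>" and g: "\<gamma>\<^sup>2 < g\<^sup>2" and h: "1 \<le> h"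
  shows "pos_def (mat (g\<^sup>2) - P g t)" "quad_form (P g t) v \<le> \<gamma>\<^sup>2 * (v \<bullet> v)"
proof -
  have "pos_def (mat (g\<^sup>2) - P g t) \<and> (\<forall>v. quad_form (P g t) v \<le> \<gamma>\<^sup>2 * (v \<bullet> v))"
  proof (induction t rule: less_induct)
    case (less t)
    have "quad_form (P g t) v \<le> \<gamma>\<^sup>2 * (v \<bullet> v)" for v
      using value_bound[OF \<mu> less_imp_le[OF g], of 0 t v] less h by simp
    moreover have "pos_semidef (P g t)"
      using less by (intro P_seq_pos_semidef R_pos_def Q_pos_semidef) auto
    ultimately show ?case
      using pos_def_mat_diff_if_le[of "P g t" "\<gamma>\<^sup>2" "g\<^sup>2"] g by (simp add: pos_semidef_iff)
  qed
  then show "pos_def (mat (g\<^sup>2) - P g t)" "quad_form (P g t) v \<le> \<gamma>\<^sup>2 * (v \<bullet> v)" by auto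
qed

text \<open>The same induction for the open-loop iterates. The bound is uniform in \<open>N\<close>
  and so survives the limit.\<close>

lemma M_seq_P_seq_bound:
  assumes \<mu>: "attains_gain A B C2 D21 h \<mu> \<gamma>" and g: "\<gamma>\<^sup>2 < g\<^sup>2" and h: "1 \<le> h"
    and k: "1 \<le> k" "k \<le> h"
  shows "pos_semidef (M_seq A Q g (P g N) k)" "quad_form (M_seq A Q g (P g N) k) v \<le> \<gamma>\<^sup>2 * (v \<bullet> v)"
proof -
  have "pos_semidef (M_seq A Q g (P g N) k) \<and>
      (\<forall>v. quad_form (M_seq A Q g (P g N) k) v \<le> \<gamma>\<^sup>2 * (v \<bullet> v))"
    using k
  proof (induction k rule: less_induct)
    case (less k)
    have pd: "pos_def (mat (g\<^sup>2) - M_seq A Q g (P g N) j)" if "1 \<le> j" "j < k" for j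
      using less.IH[OF that(2,1)] less.prems that pos_def_mat_diff_if_le[OF _ _ g, of "M_seq A Q g (P g N) j"]
      by (simp add: pos_semidef_iff)
    have "quad_form (M_seq A Q g (P g N) k) v \<le> \<gamma>\<^sup>2 * (v \<bullet> v)" for v
      using value_bound[OF \<mu> less_imp_le[OF g], of "k - 1" N v] less.prems pd P_seq_bound(1)[OF \<mu> g h]
      by simp
    moreover have "pos_semidef (M_seq A Q g (P g N) k)"
      using less.prems pd P_seq_bound(1)[OF \<mu> g h]
      by (intro M_seq_pos_semidef P_seq_pos_semidef R_pos_def Q_pos_semidef) auto
    ultimately show ?case by blast
  qed
  then show "pos_semidef (M_seq A Q g (P g N) k)" "quad_form (M_seq A Q g (P g N) k) v \<le> \<gamma>\<^sup>2 * (v \<bullet> v)"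
    by auto
qed

text \<open>Worded exactly as the condition under the infimum in (ii), which unfolding then
  produces.\<close>

definition admissible :: "nat \<Rightarrow> real \<Rightarrow> real^'n^'n \<Rightarrow> bool" where
  "admissible h \<gamma> L \<longleftrightarrow> is_Pbar A B Q R \<gamma> L \<and> L \<prec> mat (\<gamma>\<^sup>2) \<and>
     (\<forall>k\<in>{1..h}. 0 \<prec> mat (\<gamma>\<^sup>2) - M_seq A Q \<gamma> L k)"

text \<open>Monotone bounded iterates converge, continuity gives the Riccati equation, and the
  bounds by \<open>\<gamma>\<^sup>2\<close> pass to the limit, where they are strict for
  \<open>g\<close>.\<close>

lemma attained_imp_admissible:
  assumes \<mu>: "attains_gain A B C2 D21 h \<mu> \<gamma>" and g: "\<gamma>\<^sup>2 < g\<^sup>2" and h: "1 \<le> h"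
  shows "\<exists>L. admissible h g L"
proof -
  note pd = P_seq_bound(1)[OF assms]
  have psd: "pos_semidef (P g t)" for t
    by (intro P_seq_pos_semidef R_pos_def Q_pos_semidef pd)
  have mono: "quad_form (P g t) v \<le> quad_form (P g (Suc t)) v" for t v
    by (intro P_seq_mono_step R_pos_def Q_pos_semidef pd)
  have sym: "transpose (P g t) = P g t" for t
    using psd by (simp add: pos_semidef_iff)
  obtain L where L: "P g \<longlonglongrightarrow> L"
    by (rule monotone_bounded_matrix_converges[of "P g", OF sym mono P_seq_bound(2)[OF assms]])
  have le_L: "quad_form (P g t) v \<le> quad_form L v" for t v
    by (rule incseq_le[of "\<lambda>t. quad_form (P g t) v", OF incseq_SucI tendsto_quad_form[OF L]], rule mono)
  have "(\<lambda>t. P g (Suc t)) \<longlonglongrightarrow> F_c A B Q R (F_a g L)"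
    unfolding P_seq.simps(2)
    by (intro tendsto_F_c R_pos_def F_a_pos_semidef pd psd tendsto_F_a[OF L sym P_seq_bound(2)[OF assms] g])
  then have ric: "L = F_c A B Q R (F_a g L)"
    by (rule LIMSEQ_unique[OF LIMSEQ_Suc[OF L]])
  have L_pos: "pos_def L"
  proof -
    have "0 < quad_form L v" if "v \<noteq> 0" for v
    proof -
      \<comment> \<open>After \<open>CARD('n)\<close> steps the iterate is already positive
        definite, and the limit dominates it.\<close>
      have "quad_form (P g CARD('n)) v \<noteq> 0"
        using P_seq_eq_0_imp[OF pd] observable_imp_zero[OF obs] that by blast
      then have "0 < quad_form (P g CARD('n)) v"
        using psd[of "CARD('n)"] by (simp add: pos_semidef_iff order_less_le)
      then show ?thesis
        using le_L[of "CARD('n)" v] by linarith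
    qed
    then show ?thesis
      using pos_semidef_limit[OF L psd] by (simp add: pos_def_iff pos_semidef_iff)
  qed
  have M_lim: "(\<lambda>N. M_seq A Q g (P g N) k) \<longlonglongrightarrow> M_seq A Q g L k" if "1 \<le> k" "k \<le> h" for k
    using that
  proof (induction k rule: dec_induct)
    case base
    then show ?case using L by simp
  next
    case (step k)
    have "transpose (M_seq A Q g (P g N) k) = M_seq A Q g (P g N) k" for N
      using step M_seq_P_seq_bound(1)[OF assms, of k N] by (simp add: pos_semidef_iff)
    moreover have "quad_form (M_seq A Q g (P g N) k) v \<le> \<gamma>\<^sup>2 * (v \<bullet> v)" for N v
      using step by (intro M_seq_P_seq_bound(2)[OF assms]) simp_all
    moreover have "(\<lambda>N. M_seq A Q g (P g N) k) \<longlonglongrightarrow> M_seq A Q g L k"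
      using step by simp
    ultimately have "(\<lambda>N. F_a g (M_seq A Q g (P g N) k)) \<longlonglongrightarrow> F_a g (M_seq A Q g L k)"
      using g by (intro tendsto_F_a)
    then show ?case
      using step.hyps by (simp add: M_seq_Suc tendsto_F_o)
  qed
  have M_pd: "pos_def (mat (g\<^sup>2) - M_seq A Q g L k)" if k: "1 \<le> k" "k \<le> h" for k
  proof (rule pos_def_mat_diff_if_le[OF _ _ g])
    show "transpose (M_seq A Q g L k) = M_seq A Q g L k"
      using pos_semidef_limit[OF M_lim[OF k]] M_seq_P_seq_bound(1)[OF assms k]
      by (simp add: pos_semidef_iff)
    show "quad_form (M_seq A Q g L k) v \<le> \<gamma>\<^sup>2 * (v \<bullet> v)" for v
      using M_seq_P_seq_bound(2)[OF assms k]
      by (intro LIMSEQ_le_const2[OF tendsto_quad_form[OF M_lim[OF k]]]) blast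
  qed
  have "admissible h g L"
    unfolding admissible_def is_Pbar_def loewner_less_def diff_0_right
  proof (intro conjI allI ballI)
    show "pos_def (mat (g\<^sup>2) - L)"
      using M_pd[of 1] h by simp
    show "pos_def (mat (g\<^sup>2) - M_seq A Q g L k)" if "k \<in> {1..h}" for k
      using M_pd that by simp
  qed (fact pd L L_pos ric)+
  then show ?thesis by blast
qed

end

subsection \<open>Sufficiency\<close>

text \<open>Here \<open>x - \<xi>\<close> is the prediction error. The squares due to the suboptimal
  input and disturbance arise once for the state and once for the error, and cancel; the bound on
  \<open>F_a \<gamma> M\<close> is the only inequality.\<close>

lemma storage_step:
  fixes A :: "real^'n^'n" and B :: "real^'m^'n"
  assumes R: "pos_def R" and psd: "pos_semidef P" and ric: "P = F_c A B Q R (F_a \<gamma> P)"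
    and pdP: "pos_def (mat (\<gamma>\<^sup>2) - P)" and pdM: "pos_def (mat (\<gamma>\<^sup>2) - M)"
    and u: "u = - (ctrl_gain A B R (F_a \<gamma> P) *v \<xi>)"
    and x': "x' = A *v x + B *v u + w"
    and \<xi>': "\<xi>' = A *v \<xi> + B *v u + dist_gain \<gamma> P *v (A *v \<xi> + B *v u)"
  shows "quad_form Q x + quad_form R u - \<gamma>\<^sup>2 * (w \<bullet> w)
      + (quad_form P x' + quad_form M (x' - \<xi>') - quad_form P (x' - \<xi>'))
    \<le> quad_form P x + quad_form (F_o A Q (F_a \<gamma> M)) (x - \<xi>) - quad_form P (x - \<xi>)"
proof -
  let ?X = "F_a \<gamma> P" and ?y = "A *v x + B *v u" and ?e = "x - \<xi>"
  let ?K = "ctrl_gain A B R ?X" and ?D = "dist_gain \<gamma> P"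
  \<comment> \<open>The error is driven by the actual disturbance minus the predicted one.\<close>
  let ?v = "(x' - \<xi>') - A *v ?e"
  have psdX: "pos_semidef ?X"
    by (rule F_a_pos_semidef[OF pdP psd])
  have "u + ?K *v x = ?K *v ?e"
    by (simp add: u matrix_vector_mult_diff_distrib)
  then have 1: "quad_form Q x + quad_form R u + quad_form ?X ?y
      = quad_form P x + quad_form (ctrl_weight B R ?X) (?K *v ?e)"
    using F_c_square[OF R psdX, of Q x u A B] ric[symmetric] by simp
  \<comment> \<open>Zero input at the error leaves the same square as the actual input leaves at the
    state.\<close>
  have 2: "quad_form Q ?e + quad_form ?X (A *v ?e)
      = quad_form P ?e + quad_form (ctrl_weight B R ?X) (?K *v ?e)"
    using F_c_square[OF R psdX, of Q ?e 0 A B] ric[symmetric] by simp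
  have 3: "quad_form P x' - \<gamma>\<^sup>2 * (w \<bullet> w)
      = quad_form ?X ?y - quad_form (mat (\<gamma>\<^sup>2) - P) (w - ?D *v ?y)"
    unfolding x' by (rule F_a_square[OF pdP])
  have 4: "quad_form M (x' - \<xi>') - \<gamma>\<^sup>2 * (?v \<bullet> ?v) \<le> quad_form (F_a \<gamma> M) (A *v ?e)"
    using F_a_upper[OF pdM, of "A *v ?e" ?v] by simp
  \<comment> \<open>This identifies the disturbance squares in 3 and 5.\<close>
  have "?v - ?D *v (A *v ?e) = w - ?D *v ?y"
    by (simp add: x' \<xi>' matrix_vector_mult_diff_distrib matrix_vector_right_distrib)
  then have 5: "quad_form P (x' - \<xi>') - \<gamma>\<^sup>2 * (?v \<bullet> ?v)
      = quad_form ?X (A *v ?e) - quad_form (mat (\<gamma>\<^sup>2) - P) (w - ?D *v ?y)"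
    using F_a_square[OF pdP, of "A *v ?e" ?v] by simp
  show ?thesis
    using 1 2 3 4 5 quad_form_F_o[of A Q "F_a \<gamma> M" ?e] by linarith
qed

text \<open>Terms are nonnegative, so bounds on partial sums give both summability and the norm
  bound.\<close>

lemma attains_gainI:
  assumes "\<And>w x u z T. in_l2 w \<Longrightarrow> closed_loop A B C2 D21 h \<mu> w x u z \<Longrightarrow>
    (\<Sum>t<T. z t \<bullet> z t) \<le> \<gamma>\<^sup>2 * l2_normsq w"
  shows "attains_gain A B C2 D21 h \<mu> \<gamma>"
  unfolding attains_gain_def
proof (intro allI impI)
  fix w x u z
  assume "in_l2 w" "closed_loop A B C2 D21 h \<mu> w x u z"
  note bound = assms[OF this]
  have "summable (\<lambda>t. z t \<bullet> z t)"
    by (rule summableI_nonneg_bounded[OF _ bound]) simp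
  then show "in_l2 z \<and> l2_normsq z \<le> \<gamma>\<^sup>2 * l2_normsq w"
    using suminf_le_const[OF _ bound] by (simp add: in_l2_def l2_normsq_def)
qed

text \<open>The start of the current block of length \<open>N\<close> is a sampling time. Applied
  with \<open>N = h\<close> and with the longer deadbeat blocks.\<close>

lemma sampled_info_block:
  "h dvd N \<Longrightarrow> sampled_info h x t (t - t mod N) = x (t - t mod N)"
  by (simp add: sampled_info_def minus_mod_eq_mult_div)

context plant
begin

text \<open>Certainty equivalence: between samples the state is predicted by a model driven by the
  worst-case disturbance.\<close>

lemma admissible_imp_attained:
  assumes adm: "admissible h \<gamma> L" and h: "1 \<le> h"
  shows "\<exists>\<mu>. attains_gain A B C2 D21 h \<mu> \<gamma>"
proof -
  have pdM: "pos_def (mat (\<gamma>\<^sup>2) - M_seq A Q \<gamma> L k)" if "1 \<le> k" "k \<le> h" for k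
    using adm that by (simp add: admissible_def loewner_less_def)
  have pdL: "pos_def (mat (\<gamma>\<^sup>2) - L)" and ric: "L = F_c A B Q R (F_a \<gamma> L)"
    and "pos_def L"
    using adm unfolding admissible_def is_Pbar_def loewner_less_def diff_0_right by blast+
  then have psd: "pos_semidef L"
    by (intro pos_def_imp_pos_semidef)
  define K where "K = ctrl_gain A B R (F_a \<gamma> L)"
  \<comment> \<open>One prediction step: the certainty-equivalent input, then the disturbance that
    is worst for \<open>L\<close>.\<close>
  define \<Phi> where "\<Phi> = (mat 1 + dist_gain \<gamma> L) ** (A - B ** K)"
  define \<mu> where "\<mu> = (\<lambda>t i. - (K *v (mpow \<Phi> (t mod h) *v i (t - t mod h :: nat))))"
  have "attains_gain A B C2 D21 h \<mu> \<gamma>"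
  proof (rule attains_gainI)
    fix w x u z T
    assume w: "in_l2 w" and cl: "closed_loop A B C2 D21 h \<mu> w x u z"
    define \<xi> where "\<xi> = (\<lambda>t. mpow \<Phi> (t mod h) *v x (t - t mod h))"
    \<comment> \<open>The index counts down from \<open>h + 1\<close> to 2 within a block. The value
      \<open>h + 1\<close> occurs only at samples, where the error is zero.\<close>
    define V where "V = (\<lambda>t. quad_form L (x t)
      + quad_form (M_seq A Q \<gamma> L (h + 1 - t mod h)) (x t - \<xi> t) - quad_form L (x t - \<xi> t))"
    have x: "x 0 = 0" "x (Suc t) = A *v x t + B *v u t + w t" for t
      using cl by (simp_all add: closed_loop_def)
    have u: "u t = - (K *v \<xi> t)" for t
      using cl by (simp add: closed_loop_def \<mu>_def \<xi>_def sampled_info_block)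
    have zz: "z t \<bullet> z t = quad_form Q (x t) + quad_form R (u t)" for t
      using cl by (simp add: closed_loop_def output_normsq)
    have step: "z t \<bullet> z t - \<gamma>\<^sup>2 * (w t \<bullet> w t) + V (Suc t) \<le> V t" for t
    proof -
      define j where "j = t mod h"
      have j: "j < h" using h by (simp add: j_def)
      define \<xi>' where "\<xi>' = \<Phi> *v \<xi> t"
      have \<xi>': "\<xi>' = A *v \<xi> t + B *v u t + dist_gain \<gamma> L *v (A *v \<xi> t + B *v u t)"
        by (simp add: \<xi>'_def \<Phi>_def u linear_neg[OF matrix_vector_mul_linear]
            matrix_vector_mult_add_rdistrib matrix_vector_mult_diff_rdistrib
            flip: matrix_vector_mul_assoc)
      have "V (Suc t) = quad_form L (x (Suc t))
          + quad_form (M_seq A Q \<gamma> L (h - j)) (x (Suc t) - \<xi>') - quad_form L (x (Suc t) - \<xi>')"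
      proof (cases "Suc j = h")
        \<comment> \<open>At the end of a block the weight is \<open>M_1 = L\<close>, so the two
          error terms cancel and the reset of the prediction leaves \<open>V\<close>
          unchanged.\<close>
        case True
        then have "Suc t mod h = 0"
          by (simp add: j_def mod_Suc)
        then show ?thesis
          using True[symmetric] by (simp add: V_def \<xi>_def)
      next
        case False
        then have "Suc t mod h = Suc j"
          by (simp add: j_def mod_Suc)
        moreover from this have "\<xi> (Suc t) = \<xi>'"
          by (simp add: \<xi>_def \<xi>'_def mpow_Suc flip: matrix_vector_mul_assoc j_def)
        ultimately show ?thesis
          by (simp add: V_def)
      qed
      moreover have "M_seq A Q \<gamma> L (h + 1 - t mod h) = F_o A Q (F_a \<gamma> (M_seq A Q \<gamma> L (h - j)))"
        using j M_seq_Suc[of "h - j" A Q \<gamma> L] by (simp add: j_def Suc_diff_le)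
      then have "V t = quad_form L (x t)
          + quad_form (F_o A Q (F_a \<gamma> (M_seq A Q \<gamma> L (h - j)))) (x t - \<xi> t) - quad_form L (x t - \<xi> t)"
        by (simp only: V_def)
      moreover have "pos_def (mat (\<gamma>\<^sup>2) - M_seq A Q \<gamma> L (h - j))"
        using j by (intro pdM) auto
      note storage_step[OF R_pos_def psd ric pdL this u[of t, unfolded K_def] x(2) \<xi>']
      ultimately show ?thesis
        unfolding zz by linarith
    qed
    have V0: "V 0 = 0"
      by (simp add: V_def \<xi>_def x)
    have nonneg: "0 \<le> V t" for t
    proof -
      have "quad_form L (x t - \<xi> t) \<le> quad_form (M_seq A Q \<gamma> L (h + 1 - t mod h)) (x t - \<xi> t)"
      proof (cases "t mod h = 0")
        case True
        then show ?thesis by (simp add: \<xi>_def)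
      next
        case False
        then show ?thesis
          using mod_less_divisor[of h t] h by (intro M_seq_ge_start[OF R_pos_def psd ric pdM]) linarith+
      qed
      moreover have "0 \<le> quad_form L (x t)"
        using psd by (simp add: pos_semidef_iff)
      ultimately show ?thesis by (simp add: V_def)
    qed
    have "(\<Sum>t<T. z t \<bullet> z t - \<gamma>\<^sup>2 * (w t \<bullet> w t)) + V T \<le> 0"
    proof (induction T)
      case (Suc T)
      then show ?case using step[of T] by simp
    qed (simp add: V0)
    then have "(\<Sum>t<T. z t \<bullet> z t) \<le> \<gamma>\<^sup>2 * (\<Sum>t<T. w t \<bullet> w t)"
      using nonneg[of T] by (simp add: sum_subtractf sum_distrib_left)
    also have "\<dots> \<le> \<gamma>\<^sup>2 * l2_normsq w"
      by (intro mult_left_mono sum_le_l2_normsq w) simp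
    finally show "(\<Sum>t<T. z t \<bullet> z t) \<le> \<gamma>\<^sup>2 * l2_normsq w" .
  qed
  then show ?thesis by blast
qed

end

subsection \<open>A deadbeat controller has finite gain\<close>

lemma sum_matrix_vector_mult: "(\<Sum>k\<in>I. X k) *v v = (\<Sum>k\<in>I. X k *v v)"
  for X :: "'a \<Rightarrow> real^'n^'m"
  by (induction I rule: infinite_finite_induct) (simp_all add: matrix_vector_mult_add_rdistrib)

text \<open>Inputs reaching a target can be chosen linear in it. Zero padding of \<open>U\<close>
  beyond \<open>CARD('n)\<close> allows any longer horizon.\<close>

lemma controllable_right_inverse:
  fixes A :: "real^'n^'n" and B :: "real^'m^'n"
  assumes "controllable A B"
  obtains U where "\<And>N v. CARD('n) \<le> N \<Longrightarrow> (\<Sum>k<N. mpow A k *v (B *v (U k *v v))) = v"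
proof -
  define S where "S = {v. \<exists>q :: nat \<Rightarrow> real^'m. v = (\<Sum>k<CARD('n). mpow A k *v (B *v q k))}"
  have "subspace S"
    unfolding subspace_def
  proof (intro conjI allI ballI)
    show "0 \<in> S"
      by (auto simp: S_def intro!: exI[of _ "\<lambda>_. 0"])
    fix v w c
    assume "v \<in> S"
    then obtain p where p: "v = (\<Sum>k<CARD('n). mpow A k *v (B *v p k))"
      by (auto simp: S_def)
    show "c *\<^sub>R v \<in> S"
      by (auto simp: S_def p scaleR_sum_right matrix_vector_mult_scaleR intro!: exI[of _ "\<lambda>k. c *\<^sub>R p k"])
    assume "w \<in> S"
    then obtain q where q: "w = (\<Sum>k<CARD('n). mpow A k *v (B *v q k))"
      by (auto simp: S_def)
    show "v + w \<in> S"
      by (auto simp: S_def p q sum.distrib matrix_vector_right_distrib intro!: exI[of _ "\<lambda>k. p k + q k"])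
  qed
  moreover have "(\<Union>k<CARD('n). columns (mpow A k ** B)) \<subseteq> S"
  proof (clarsimp simp: columns_def)
    fix k i
    assume k: "k < CARD('n)"
    have "(\<Sum>l<CARD('n). mpow A l *v (B *v (if l = k then axis i 1 else 0)))
        = (\<Sum>l<CARD('n). if l = k then mpow A k *v (B *v axis i 1) else 0)"
      by (intro sum.cong) auto
    also have "\<dots> = column i (mpow A k ** B)"
      using k by (simp add: matrix_vector_mul_assoc flip: matrix_vector_mult_basis)
    finally show "column i (mpow A k ** B) \<in> S"
      unfolding S_def
      by (intro CollectI exI[of _ "\<lambda>l. if l = k then axis i 1 else 0"]) (rule sym)
  qed
  ultimately have "S = UNIV"
    using assms span_minimal unfolding controllable_def by blast
  then have "\<forall>i. \<exists>q. axis i 1 = (\<Sum>k<CARD('n). mpow A k *v (B *v q k))"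
    unfolding S_def by blast
  then obtain q where q: "\<And>i. axis i 1 = (\<Sum>k<CARD('n). mpow A k *v (B *v q i k))"
    by metis
  \<comment> \<open>Column \<open>i\<close> of \<open>U k\<close> is the input that helps to reach
    unit vector \<open>i\<close>, so \<open>G\<close> below fixes every unit vector.\<close>
  define U where "U = (\<lambda>k. if k < CARD('n) then (\<chi> a i. q i k $ a) else 0)"
  have "(\<Sum>k<N. mpow A k *v (B *v (U k *v v))) = v" if N: "CARD('n) \<le> N" for N v
  proof -
    define G where "G = (\<Sum>k<CARD('n). mpow A k ** B ** U k)"
    have G: "G *v y = (\<Sum>k<CARD('n). mpow A k *v (B *v (U k *v y)))" for y
      by (simp add: G_def sum_matrix_vector_mult flip: matrix_vector_mul_assoc)
    have basis: "G *v axis i 1 = axis i 1" for i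
    proof -
      have "U k *v axis i 1 = q i k" if "k < CARD('n)" for k
        using that by (simp add: U_def matrix_vector_mult_basis column_def vec_eq_iff)
      then have "G *v axis i 1 = (\<Sum>k<CARD('n). mpow A k *v (B *v q i k))"
        by (simp add: G)
      then show ?thesis
        by (simp only: q[of i, symmetric])
    qed
    have "G $ a $ i = mat 1 $ a $ i" for a i
    proof -
      have "G $ a $ i = (G *v axis i 1) $ a"
        by (simp add: matrix_vector_mult_basis column_def)
      also have "\<dots> = mat 1 $ a $ i"
        unfolding basis by (simp add: mat_def axis_def)
      finally show ?thesis .
    qed
    then have "G = mat 1"
      by (simp add: vec_eq_iff)
    then have "(\<Sum>k<CARD('n). mpow A k *v (B *v (U k *v v))) = v"
      using G[of v] by simp
    moreover have "(\<Sum>k<N. mpow A k *v (B *v (U k *v v))) = (\<Sum>k<CARD('n). mpow A k *v (B *v (U k *v v)))"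
      using N by (intro sum.mono_neutral_right) (auto simp: U_def)
    ultimately show ?thesis by simp
  qed
  then show thesis using that by blast
qed

lemma matrix_family_bounded:
  fixes X :: "nat \<Rightarrow> real^'n^'m"
  obtains c where "0 < c" "\<And>k v. k < N \<Longrightarrow> norm (X k *v v) \<le> c * norm v"
proof -
  have "\<exists>c>0. \<forall>k<N. \<forall>v. norm (X k *v v) \<le> c * norm v"
  proof (induction N)
    case 0
    show ?case by (auto intro: exI[of _ 1])
  next
    case (Suc N)
    then obtain c where c: "0 < c" "\<And>k v. k < N \<Longrightarrow> norm (X k *v v) \<le> c * norm v"
      by blast
    obtain d where d: "0 < d" "\<And>v. norm (X N *v v) \<le> d * norm v"
      using linear_bounded_pos[OF matrix_vector_mul_linear[of "X N"]] by blast
    have "norm (X k *v v) \<le> (c + d) * norm v" if "k < Suc N" for k v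
    proof (cases "k = N")
      case True
      then show ?thesis
        using c(1) by (intro order_trans[OF d(2)[of v, folded True]] mult_right_mono) auto
    next
      case False
      then show ?thesis
        using d(1) that by (intro order_trans[OF c(2)] mult_right_mono) auto
    qed
    then show ?case
      using c(1) d(1) by (intro exI[of _ "c + d"]) simp
  qed
  then show thesis using that by blast
qed

text \<open>Discrete variation of constants, with total forcing \<open>f\<close>.\<close>

lemma state_formula:
  assumes "\<And>t. x (Suc t) = A *v x t + f t"
  shows "x (r + j) = mpow A j *v x r + (\<Sum>i<j. mpow A (j - Suc i) *v f (r + i))"
proof (induction j)
  case (Suc j)
  have "(\<Sum>i<j. mpow A (j - i) *v f (r + i)) = A *v (\<Sum>i<j. mpow A (j - Suc i) *v f (r + i))"
    unfolding linear_sum[OF matrix_vector_mul_linear]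
  proof (intro sum.cong refl)
    fix i
    assume "i \<in> {..<j}"
    then show "mpow A (j - i) *v f (r + i) = A *v (mpow A (j - Suc i) *v f (r + i))"
      by (simp add: matrix_vector_mul_assoc flip: mpow_Suc Suc_diff_Suc)
  qed
  then show ?case
    by (simp add: assms Suc mpow_Suc matrix_vector_right_distrib flip: matrix_vector_mul_assoc)
qed simp

context plant
begin

text \<open>The inputs, fixed at the block start, cancel the free response \<open>A^N x_r\<close>.
  The input at \<open>r + i\<close> acts through \<open>A^(N-1-i)\<close>, hence the reversed index
  of \<open>U\<close>.\<close>

lemma deadbeat_block:
  assumes U: "\<And>v. (\<Sum>k<N. mpow A k *v (B *v (U k *v v))) = v"
    and x: "\<And>t. x (Suc t) = A *v x t + B *v u t + w t"
    and u: "\<And>i. i < N \<Longrightarrow> u (r + i) = - (U (N - Suc i) *v (mpow A N *v x r))"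
  shows "x (r + N) = (\<Sum>i<N. mpow A (N - Suc i) *v w (r + i))"
proof -
  have "(\<Sum>i<N. mpow A (N - Suc i) *v (B *v u (r + i)))
      = - (\<Sum>i<N. mpow A (N - Suc i) *v (B *v (U (N - Suc i) *v (mpow A N *v x r))))"
    unfolding sum_negf[symmetric] by (intro sum.cong) (simp_all add: u linear_neg)
  also have "\<dots> = - (mpow A N *v x r)"
    using sum.nat_diff_reindex[of "\<lambda>k. mpow A k *v (B *v (U k *v (mpow A N *v x r)))" N] U by simp
  finally show ?thesis
    using state_formula[of x A "\<lambda>t. B *v u t + w t" r N] x
    by (simp add: matrix_vector_right_distrib sum.distrib add.assoc)
qed

text \<open>The state at a block start depends only on the disturbances of the previous block, so
  effects cannot accumulate.\<close>

lemma finite_gain_exists: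
  assumes h: "1 \<le> h"
  shows "\<exists>\<gamma>>0. \<exists>\<mu>. attains_gain A B C2 D21 h \<mu> \<gamma>"
proof -
  obtain U where U: "\<And>N v. CARD('n) \<le> N \<Longrightarrow> (\<Sum>k<N. mpow A k *v (B *v (U k *v v))) = v"
    using controllable_right_inverse[OF ctrl] by blast
  \<comment> \<open>A multiple of \<open>h\<close>, so that blocks start at samples, and at least
    \<open>CARD('n)\<close>, so that deadbeat is possible.\<close>
  define N where "N = h * CARD('n)"
  have N: "CARD('n) \<le> N" "0 < N"
    using h by (simp_all add: N_def)
  define \<mu> where "\<mu> = (\<lambda>t i. - (U (N - Suc (t mod N)) *v (mpow A N *v i (t - t mod N :: nat))))"
  obtain a where a: "0 < a" "\<And>k v. k < N \<Longrightarrow> norm (mpow A k *v v) \<le> a * norm v"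
    using matrix_family_bounded[of N "mpow A"] by blast
  obtain b where b: "0 < b" "\<And>k v. k < N \<Longrightarrow> norm ((B ** U k ** mpow A N) *v v) \<le> b * norm v"
    using matrix_family_bounded[of N "\<lambda>k. B ** U k ** mpow A N"] by blast
  obtain c where c: "0 < c" "\<And>v. norm (C2 *v v) \<le> c * norm v"
    using linear_bounded_pos[OF matrix_vector_mul_linear[of C2]] by blast
  obtain d where d: "0 < d" "\<And>k v. k < N \<Longrightarrow> norm ((D21 ** U k ** mpow A N) *v v) \<le> d * norm v"
    using matrix_family_bounded[of N "\<lambda>k. D21 ** U k ** mpow A N"] by blast
  define E where "E = c * a * (1 + N * b) + d"
  \<comment> \<open>The first \<open>N\<close> counts the times in a block,
    \<open>2 * E\<^sup>2\<close> comes from squaring a sum of two terms,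
    \<open>a\<^sup>2 + 1\<close> from start states and disturbances, and the last \<open>N\<close>
    from Cauchy-Schwarz.\<close>
  define G where "G = N * (2 * E\<^sup>2) * (a\<^sup>2 + 1) * N"
  have G: "0 \<le> G"
    by (simp add: G_def)
  \<comment> \<open>\<open>1 + G\<close> is positive and its square exceeds \<open>G\<close>, which
    avoids a square root.\<close>
  have "attains_gain A B C2 D21 h \<mu> (1 + G)"
  proof (rule attains_gainI)
    fix w x u z T
    assume w: "in_l2 w" and cl: "closed_loop A B C2 D21 h \<mu> w x u z"
    have x: "x 0 = 0" "x (Suc t) = A *v x t + B *v u t + w t" and z: "z t = C2 *v x t + D21 *v u t" for t
      using cl by (simp_all add: closed_loop_def)
    have u: "u (q * N + i) = - (U (N - Suc i) *v (mpow A N *v x (q * N)))" if "i < N" for q i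
      using cl that sampled_info_block[of h N x "q * N + i"]
      by (simp add: closed_loop_def \<mu>_def N_def)
    define s where "s = (\<lambda>q. norm (x (q * N)))"
    define \<sigma> where "\<sigma> = (\<lambda>q. \<Sum>i<N. norm (w (q * N + i)))"
    have s_step: "s (Suc q) \<le> a * \<sigma> q" for q
    proof -
      have "x (q * N + N) = (\<Sum>i<N. mpow A (N - Suc i) *v w (q * N + i))"
        by (rule deadbeat_block[OF U[OF N(1)] x(2) u])
      then have "s (Suc q) \<le> (\<Sum>i<N. norm (mpow A (N - Suc i) *v w (q * N + i)))"
        by (simp add: s_def add.commute norm_sum)
      also have "\<dots> \<le> (\<Sum>i<N. a * norm (w (q * N + i)))"
        by (intro sum_mono a) simp
      finally show ?thesis by (simp add: \<sigma>_def sum_distrib_left)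
    qed
    have x_bound: "norm (x (q * N + j)) \<le> a * (1 + N * b) * (s q + \<sigma> q)" if j: "j < N" for q j
    proof -
      have f: "norm (B *v u (q * N + i) + w (q * N + i)) \<le> b * s q + norm (w (q * N + i))" if "i < N" for i
        using b(2)[of "N - Suc i" "x (q * N)"] that
        by (intro norm_triangle_le add_right_mono) (simp add: u s_def linear_neg flip: matrix_vector_mul_assoc)
      have "norm (x (q * N + j)) \<le> norm (mpow A j *v x (q * N))
          + norm (\<Sum>i<j. mpow A (j - Suc i) *v (B *v u (q * N + i) + w (q * N + i)))"
        using state_formula[of x A "\<lambda>t. B *v u t + w t" "q * N" j] x
        by (simp add: norm_triangle_ineq add.assoc)
      also have "\<dots> \<le> a * s q + (\<Sum>i<j. a * (b * s q + norm (w (q * N + i))))"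
      proof (intro add_mono)
        show "norm (mpow A j *v x (q * N)) \<le> a * s q"
          using a(2)[OF j] by (simp add: s_def)
        show "norm (\<Sum>i<j. mpow A (j - Suc i) *v (B *v u (q * N + i) + w (q * N + i)))
            \<le> (\<Sum>i<j. a * (b * s q + norm (w (q * N + i))))"
          using j a by (intro sum_norm_le order_trans[OF a(2)] mult_left_mono f) auto
      qed
      also have "\<dots> \<le> a * s q + (\<Sum>i<N. a * (b * s q + norm (w (q * N + i))))"
        using j a(1) b(1) by (intro add_left_mono sum_mono2) (auto simp: s_def)
      also have "\<dots> = a * (1 + N * b) * s q + a * \<sigma> q"
        by (simp add: \<sigma>_def sum.distrib algebra_simps flip: sum_distrib_left)
      also have "\<dots> \<le> a * (1 + N * b) * s q + a * (1 + N * b) * \<sigma> q"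
        using a(1) b(1) by (intro add_left_mono mult_right_mono) (auto simp: \<sigma>_def intro: sum_nonneg)
      finally show ?thesis by (simp add: distrib_left)
    qed
    have z_bound: "norm (z (q * N + j)) \<le> E * (s q + \<sigma> q)" if j: "j < N" for q j
    proof -
      have "norm (z (q * N + j)) \<le> norm (C2 *v x (q * N + j)) + norm (D21 *v u (q * N + j))"
        unfolding z by (rule norm_triangle_ineq)
      also have "\<dots> \<le> c * (a * (1 + N * b) * (s q + \<sigma> q)) + d * (s q + \<sigma> q)"
      proof (intro add_mono)
        show "norm (C2 *v x (q * N + j)) \<le> c * (a * (1 + N * b) * (s q + \<sigma> q))"
          using c(1) by (intro order_trans[OF c(2)] mult_left_mono x_bound j) simp
        have "norm (D21 *v u (q * N + j)) \<le> d * s q"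
          using d(2)[of "N - Suc j" "x (q * N)"] j
          by (simp add: u s_def linear_neg flip: matrix_vector_mul_assoc)
        also have "\<dots> \<le> d * (s q + \<sigma> q)"
          using d(1) by (intro mult_left_mono) (auto simp: \<sigma>_def intro: sum_nonneg)
        finally show "norm (D21 *v u (q * N + j)) \<le> d * (s q + \<sigma> q)" .
      qed
      finally show ?thesis by (simp add: E_def algebra_simps)
    qed
    have z_sq: "z (q * N + j) \<bullet> z (q * N + j) \<le> 2 * E\<^sup>2 * ((s q)\<^sup>2 + (\<sigma> q)\<^sup>2)" if "j < N" for q j
    proof -
      have "(norm (z (q * N + j)))\<^sup>2 \<le> (E * (s q + \<sigma> q))\<^sup>2"
        using z_bound[OF that] by (intro power_mono) auto
      also have "\<dots> = E\<^sup>2 * (s q + \<sigma> q)\<^sup>2"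
        by (rule power_mult_distrib)
      also have "\<dots> \<le> E\<^sup>2 * (2 * ((s q)\<^sup>2 + (\<sigma> q)\<^sup>2))"
        using sum_squares_bound[of "s q" "\<sigma> q"] by (intro mult_left_mono) (simp_all add: power2_sum)
      finally show ?thesis by (simp add: dot_square_norm algebra_simps)
    qed
    have sum_s: "(\<Sum>q<m. (s q)\<^sup>2) \<le> a\<^sup>2 * (\<Sum>q<m. (\<sigma> q)\<^sup>2)" for m
    proof -
      \<comment> \<open>The extra term lets the index shift by one, as
        \<open>s 0 = 0\<close>.\<close>
      have "(\<Sum>q<m. (s q)\<^sup>2) \<le> (\<Sum>q<Suc m. (s q)\<^sup>2)"
        by simp
      also have "\<dots> = (\<Sum>q<m. (s (Suc q))\<^sup>2)"
        by (subst sum.lessThan_Suc_shift) (simp add: s_def x)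
      also have "\<dots> \<le> (\<Sum>q<m. (a * \<sigma> q)\<^sup>2)"
        by (intro sum_mono power_mono s_step) (simp add: s_def)
      finally show ?thesis by (simp add: power_mult_distrib sum_distrib_left)
    qed
    have \<sigma>_sq: "(\<sigma> q)\<^sup>2 \<le> N * (\<Sum>i<N. w (q * N + i) \<bullet> w (q * N + i))" for q
      using sum_squared_le_sum_of_squares[of "\<lambda>i. norm (w (q * N + i))" "{..<N}"]
      by (simp add: \<sigma>_def dot_square_norm mult.commute)
    have block: "(\<Sum>t<m * N. f t) = (\<Sum>q<m. \<Sum>j<N. f (q * N + j))" for f :: "nat \<Rightarrow> real" and m
      unfolding sum.nat_group[symmetric]
      by (rule sum.cong[OF refl])
        (simp add: lessThan_atLeast0 sum.atLeastLessThan_shift_0[of f "_ * N"])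
    \<comment> \<open>\<open>T * N\<close> extends the horizon to whole blocks.\<close>
    have "(\<Sum>t<T. z t \<bullet> z t) \<le> (\<Sum>t<T * N. z t \<bullet> z t)"
      using N(2) by (intro sum_mono2) auto
    also have "\<dots> \<le> (\<Sum>q<T. \<Sum>j<N. 2 * E\<^sup>2 * ((s q)\<^sup>2 + (\<sigma> q)\<^sup>2))"
      unfolding block by (intro sum_mono z_sq) simp
    also have "\<dots> = N * (2 * E\<^sup>2) * ((\<Sum>q<T. (s q)\<^sup>2) + (\<Sum>q<T. (\<sigma> q)\<^sup>2))"
      by (simp add: sum.distrib algebra_simps flip: sum_distrib_left)
    also have "\<dots> \<le> N * (2 * E\<^sup>2) * ((a\<^sup>2 + 1) * (\<Sum>q<T. (\<sigma> q)\<^sup>2))"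
      using sum_s[of T] by (intro mult_left_mono) (auto simp: distrib_right)
    also have "\<dots> \<le> N * (2 * E\<^sup>2) * ((a\<^sup>2 + 1) * (\<Sum>q<T. N * (\<Sum>i<N. w (q * N + i) \<bullet> w (q * N + i))))"
      by (intro mult_left_mono sum_mono \<sigma>_sq) auto
    also have "\<dots> = G * (\<Sum>t<T * N. w t \<bullet> w t)"
      unfolding block by (simp add: G_def flip: sum_distrib_left)
    also have "\<dots> \<le> (1 + G)\<^sup>2 * l2_normsq w"
    proof (intro mult_mono sum_le_l2_normsq w)
      show "G \<le> (1 + G)\<^sup>2"
        using G by (simp add: power2_sum)
    qed (auto intro: sum_nonneg)
    finally show "(\<Sum>t<T. z t \<bullet> z t) \<le> (1 + G)\<^sup>2 * l2_normsq w" .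
  qed
  moreover have "0 < 1 + G"
    using G by simp
  ultimately show ?thesis by blast
qed

text \<open>Admissible levels are attained, and every level above an attained one is admissible;
  this suffices for equal infima. Nonemptiness is stated for use in (iii).\<close>

lemma gamma_opt_eq:
  assumes h: "1 \<le> h"
  shows "Inf {\<gamma>. 0 < \<gamma> \<and> (\<exists>L. admissible h \<gamma> L)} = gamma_opt A B C2 D21 h"
    and "{\<gamma>. 0 < \<gamma> \<and> (\<exists>L. admissible h \<gamma> L)} \<noteq> {}"
proof -
  let ?adm = "{\<gamma>. 0 < \<gamma> \<and> (\<exists>L. admissible h \<gamma> L)}"
  let ?att = "{\<gamma>. 0 < \<gamma> \<and> (\<exists>\<mu>. attains_gain A B C2 D21 h \<mu> \<gamma>)}"
  have sub: "?adm \<subseteq> ?att"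
    using admissible_imp_attained[OF _ h] by blast
  have above: "g \<in> ?adm" if \<gamma>: "\<gamma> \<in> ?att" "\<gamma> < g" for \<gamma> g
  proof -
    have "\<gamma>\<^sup>2 < g\<^sup>2"
      using \<gamma> by (intro power_strict_mono) auto
    then show ?thesis
      using \<gamma> attained_imp_admissible[OF _ _ h] by fastforce
  qed
  obtain \<gamma>0 where \<gamma>0: "\<gamma>0 \<in> ?att"
    using finite_gain_exists[OF h] by blast
  then show nonempty: "?adm \<noteq> {}"
    using above[of \<gamma>0 "\<gamma>0 + 1"] by (metis empty_iff less_add_one)
  have bdd: "bdd_below ?adm" "bdd_below ?att"
    by (auto intro!: bdd_belowI[of _ 0])
  have "Inf ?adm \<le> \<gamma>" if "\<gamma> \<in> ?att" for \<gamma>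
    \<comment> \<open>Lets the level \<open>g\<close> decrease to \<open>\<gamma>\<close>.\<close>
    by (rule dense_ge) (rule cInf_lower[OF above[OF that] bdd(1)])
  then have "Inf ?adm \<le> Inf ?att"
    using \<gamma>0 by (intro cInf_greatest[of ?att]) blast+
  moreover have "Inf ?att \<le> Inf ?adm"
    by (rule cInf_superset_mono[OF nonempty bdd(2) sub])
  ultimately show "Inf ?adm = gamma_opt A B C2 D21 h"
    by (simp add: gamma_opt_def)
qed

end

theorem lemma1:
  fixes A :: "real^'n^'n" and B :: "real^'m^'n"
    and C2 :: "real^'n^'p" and D21 :: "real^'m^'p"
    and Q :: "real^'n^'n" and R :: "real^'m^'m"
  assumes "transpose C2 ** D21 = 0"
    and "Q = transpose C2 ** C2"
    and "R = transpose D21 ** D21"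
    and "0 \<prec> R"
    and "controllable A B"
    and "observable A C2"
  shows
    "(\<forall>\<gamma> Pbar. \<forall>h\<ge>1. 0 < \<gamma> \<longrightarrow> is_Pbar A B Q R \<gamma> Pbar \<longrightarrow> Pbar \<prec> mat (\<gamma>\<^sup>2) \<longrightarrow>
        (\<forall>k\<in>{1..h}. 0 \<prec> mat (\<gamma>\<^sup>2) - M_seq A Q \<gamma> Pbar k) \<longrightarrow>
        (\<forall>k\<in>{1..h-1}. M_seq A Q \<gamma> Pbar k \<preceq> M_seq A Q \<gamma> Pbar (k + 1)))
     \<and> (\<forall>h\<ge>1. Inf {\<gamma>. 0 < \<gamma> \<and>
            (\<exists>Pbar. is_Pbar A B Q R \<gamma> Pbar \<and> Pbar \<prec> mat (\<gamma>\<^sup>2) \<and>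
               (\<forall>k\<in>{1..h}. 0 \<prec> mat (\<gamma>\<^sup>2) - M_seq A Q \<gamma> Pbar k))}
          = gamma_opt A B C2 D21 h)
     \<and> (\<forall>h\<ge>1. gamma_opt A B C2 D21 h \<le> gamma_opt A B C2 D21 (h + 1))"
proof -
  interpret plant A B C2 D21 Q R
    using assms by unfold_locales (simp_all add: loewner_less_def)
  have mono: "M_seq A Q \<gamma> Pbar k \<preceq> M_seq A Q \<gamma> Pbar (k + 1)"
    if Pbar: "is_Pbar A B Q R \<gamma> Pbar" and pd: "\<forall>k\<in>{1..h}. 0 \<prec> mat (\<gamma>\<^sup>2) - M_seq A Q \<gamma> Pbar k"
      and k: "k \<in> {1..h - 1}" for \<gamma> Pbar h k
  proof -
    have "pos_def Pbar" and ric: "Pbar = F_c A B Q R (F_a \<gamma> Pbar)"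
      using Pbar unfolding is_Pbar_def loewner_less_def diff_0_right by blast+
    then have psd: "pos_semidef Pbar"
      by (intro pos_def_imp_pos_semidef)
    have pd': "pos_def (mat (\<gamma>\<^sup>2) - M_seq A Q \<gamma> Pbar j)" if "1 \<le> j" "j \<le> Suc k" for j
    proof -
      have "j \<in> {1..h}" using k that by auto
      then show ?thesis using pd by (simp add: loewner_less_def)
    qed
    \<comment> \<open>\<open>\<preceq>\<close> includes symmetry, read off here from the conditions
      for \<open>k\<close> and \<open>k + 1\<close>; this is where \<open>k + 1 \<le> h\<close>
      enters.\<close>
    have "transpose (M_seq A Q \<gamma> Pbar j) = M_seq A Q \<gamma> Pbar j" if "1 \<le> j" "j \<le> Suc k" for j
      using pd'[OF that] by (simp add: pos_def_iff transpose_mat_diff_iff)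
    moreover have "quad_form (M_seq A Q \<gamma> Pbar k) v \<le> quad_form (M_seq A Q \<gamma> Pbar (Suc k)) v" for v
      using k pd' by (intro M_seq_mono_step[OF R_pos_def psd ric]) auto
    ultimately show ?thesis
      using k by (simp add: loewner_le_def pos_semidef_iff quad_form_diff transpose_diff)
  qed
  have "gamma_opt A B C2 D21 h \<le> gamma_opt A B C2 D21 (h + 1)" if h: "1 \<le> h" for h
  proof -
    have "{\<gamma>. 0 < \<gamma> \<and> (\<exists>L. admissible (h + 1) \<gamma> L)} \<subseteq> {\<gamma>. 0 < \<gamma> \<and> (\<exists>L. admissible h \<gamma> L)}"
      by (auto simp: admissible_def)
    then have "Inf {\<gamma>. 0 < \<gamma> \<and> (\<exists>L. admissible h \<gamma> L)} \<le> Inf {\<gamma>. 0 < \<gamma> \<and> (\<exists>L. admissible (h + 1) \<gamma> L)}"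
      \<comment> \<open>The infimum over the subset compares as desired because that subset is
        nonempty.\<close>
      using h by (intro cInf_superset_mono gamma_opt_eq(2)) (auto intro!: bdd_belowI[of _ 0])
    then show ?thesis
      using gamma_opt_eq(1)[of h] gamma_opt_eq(1)[of "h + 1"] h by simp
  qed
  then show ?thesis
    using mono gamma_opt_eq(1)[unfolded admissible_def] by (intro conjI allI impI ballI)
qed

end
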